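(* Let $\tau_k^{(\alpha)}$, $k,\alpha\in\mathbb{Z}$, be the $\tau$-functions defined in the context. For $k<0$ and all $\alpha\in\mathbb{Z}$ we have $\tau_k^{(\alpha)}=0$, and $\tau_0^{(\alpha)}=1$. For $k>0$ and all $\alpha\in\mathbb{Z}$, $$\tau_k^{(\alpha)}=\frac1{k!}\mathrm{Res}_{\mathbf w}\left(\prod_{i=1}^{k}C^{(\alpha)}(w_i)\prod_{1\le i<j\le k}(w_i-w_j)^2\right)=(-1)^{k\alpha}\det\begin{bmatrix}c_\alpha&c_{\alpha+1}&\cdots&c_{\alpha+k-1}\\c_{\alpha+1}&c_{\alpha+2}&\cdots&c_{\alpha+k}\\\vdots&\vdots&&\vdots\\c_{\alpha+k-1}&c_{\alpha+k}&\cdots&c_{\alpha+2k-2}\end{bmatrix},$$ where $\mathrm{Res}_{\mathbf w}=\mathrm{Res}_{w_1}\mathrm{Res}_{w_2}\cdots\mathrm{Res}_{w_k}$.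
   Context: Two-component Fock space. Let $e_0,e_1$ be the standard basis of $\mathbb{C}^2$ and $e_az^k$ ($a=0,1$, $k\in\mathbb{Z}$) the corresponding basis of $\mathbb{C}^2\otimes\mathbb{C}[z,z^{-1}]$. Let $v_0=e_0\wedge e_1\wedge e_0z\wedge e_1z\wedge e_0z^2\wedge\cdots$. Let $\psi^+_{a,(k)}$ be the wedging operator $\omega\mapsto e_az^k\wedge\omega$ and $\psi^-_{a,(k)}=i(e_az^{-k-1})$ the contraction operator, where $i(e_az^m)(e_az^m\wedge\beta)=\beta$ and $i(e_az^m)$ kills wedges of basis vectors not involving $e_az^m$. They satisfy $[\psi^+_{a,(k)},\psi^-_{b,(l)}]_+=\delta_{ab}\delta_{k+l,-1}$, all other anticommutators being $0$, and $\psi^\pm_{a,(k)}v_0=0$ for $k\ge0$. $F^{(2)}$ is the span of all vectors obtained from $v_0$ by finitely many such operators. A basis is given by the elementary wedges $M_1M_0v_0$, $M_a=M_a^+M_a^-$, where $M_a^\pm=\psi^\pm_{a,(k_1)}\cdots\psi^\pm_{a,(k_s)}$ with $k_1<\cdots<k_s\le-1$ ($s\ge0$); $\langle\,,\rangle$ is the bilinear form for which the elementary wedges are orthonormal. Fields: $\psi_a^\pm(w)=\sum_{k\in\mathbb{Z}}\psi^\pm_{a,(k)}w^{-k-1}$. Fermionic translation operators: $Q_0,Q_1$ are the invertible operators on $F^{(2)}$ determined by $Q_av_0=\psi^+_{a,(-1)}v_0$, $\psi_a^\pm(w)Q_a=w^{\pm1}Q_a\psi_a^\pm(w)$, $\psi^\pm_a(w)Q_b=-Q_b\psi_a^\pm(w)$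 and $Q_aQ_b=-Q_bQ_a$ for $a\ne b$. Put $T=Q_1Q_0^{-1}$. Series: $c_i$ ($i\in\mathbb{Z}$) are formal variables, $C(w)=\sum_{i\in\mathbb{Z}}c_iw^{-i-1}$, $C^{(\alpha)}(w)=(-1)^\alpha w^\alpha C(w)=\sum_i(-1)^\alpha c_{i+\alpha}w^{-i-1}$. For a series $a(w)=\sum_{i\in\mathbb{Z}}a_iw^i$, $\mathrm{Res}_w(a(w))=a_{-1}$. $\tau$-functions: $g_C^{(\alpha)}=\exp\big(\mathrm{Res}_w C^{(\alpha)}(w)\psi_1^+(w)\psi_0^-(w)\big)$, acting on $F^{(2)}$ with values in formal series in the $c_i$ (the lift of the loop group element $\begin{bmatrix}1&0\\C^{(\alpha)}(z)&1\end{bmatrix}$), and $$\tau_k^{(\alpha)}=\langle T^kv_0,g_C^{(\alpha)}v_0\rangle,\qquad k,\alpha\in\mathbb{Z}.$$ *)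

theory Defs
  imports
    Complex_Main
    "HOL-Library.Numeral_Type"
    "HOL-Library.Poly_Mapping"
    "HOL-Library.Groups_Big_Fun"
    "Jordan_Normal_Form.Determinant"
begin

section \<open>The two-component Fock space\<close>

text \<open>
  The pair \<open>(a, k)\<close> stands for the vector \<open>e\<^sub>a z\<^sup>k\<close>. A semi-infinite wedge of such vectors,
  written in the order \<open>e\<^sub>0 z\<^sup>k, e\<^sub>1 z\<^sup>k, e\<^sub>0 z\<^sup>k\<^sup>+\<^sup>1, \<dots>\<close> of the vacuum, is given by the set of
  its factors; \<open>pos\<close> is the position in that order. The Fock space is the complex vector space
  with basis the wedges whose set of factors differs from that of the vacuum by finitely many
  elements; see \<open>fock_generated\<close> below.
\<close>

type_synonym mode = "2 \<times> int"

definition pos :: "mode \<Rightarrow> int" where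
  "pos x = 2 * snd x + (if fst x = 0 then 0 else 1)"

definition vac_set :: "mode set" where
  "vac_set = {x. 0 \<le> snd x}"

typedef maya = "{S :: mode set. finite (S - vac_set) \<and> finite (vac_set - S)}"
  by (rule exI[of _ vac_set]) simp

type_synonym fock = "maya \<Rightarrow>\<^sub>0 complex"

definition fscale :: "complex \<Rightarrow> fock \<Rightarrow> fock" where
  "fscale c v = Poly_Mapping.map (\<lambda>z. c * z) v"

definition ket :: "maya \<Rightarrow> fock" where
  "ket S = Poly_Mapping.single S 1"

definition vac :: fock where
  "vac = ket (Abs_maya vac_set)"

definition lin_ext :: "(maya \<Rightarrow> fock) \<Rightarrow> fock \<Rightarrow> fock" where
  "lin_ext f v = (\<Sum>S\<in>Poly_Mapping.keys v. fscale (Poly_Mapping.lookup v S) (f S))"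

text \<open>The sign of moving a factor from the front to its place in the order.\<close>

definition wedge_sign :: "mode \<Rightarrow> maya \<Rightarrow> complex" where
  "wedge_sign x S = (-1) ^ card {y \<in> Rep_maya S. pos y < pos x}"

definition wedge :: "mode \<Rightarrow> fock \<Rightarrow> fock" where
  "wedge x = lin_ext (\<lambda>S. if x \<in> Rep_maya S then 0
     else fscale (wedge_sign x S) (ket (Abs_maya (insert x (Rep_maya S)))))"

definition contract :: "mode \<Rightarrow> fock \<Rightarrow> fock" where
  "contract x = lin_ext (\<lambda>S. if x \<in> Rep_maya S
     then fscale (wedge_sign x S) (ket (Abs_maya (Rep_maya S - {x}))) else 0)"

datatype charge = Cre | Ann

primrec charge_val :: "charge \<Rightarrow> int" where
  "charge_val Cre = 1"
| "charge_val Ann = -1"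

text \<open>
  The relations between these modes are \<open>psi_anticommutator\<close> and \<open>psi_vac\<close> below;
  \<open>psi Cre a k\<close> and \<open>psi Ann a k\<close> are the modes \<open>\<psi>\<^sup>+\<^bsub>a,(k)\<^esub>\<close> and \<open>\<psi>\<^sup>-\<^bsub>a,(k)\<^esub>\<close>.
\<close>

primrec psi :: "charge \<Rightarrow> 2 \<Rightarrow> int \<Rightarrow> fock \<Rightarrow> fock" where
  "psi Cre a k = wedge (a, k)"
| "psi Ann a k = contract (a, - k - 1)"

text \<open>A series \<open>\<Sum>\<^sub>n A\<^sub>n w\<^sup>n\<close>, infinite in both directions, is the function \<open>n \<mapsto> A\<^sub>n\<close>.\<close>

definition psi_field :: "charge \<Rightarrow> 2 \<Rightarrow> int \<Rightarrow> fock \<Rightarrow> fock" where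
  "psi_field s a n = psi s a (- n - 1)"

definition w_times :: "int \<Rightarrow> (int \<Rightarrow> 'x) \<Rightarrow> int \<Rightarrow> 'x" where
  "w_times d A = (\<lambda>n. A (n - d))"

definition Res :: "(int \<Rightarrow> 'x) \<Rightarrow> 'x" where
  "Res A = A (-1)"


subsection \<open>Elementary wedges and the bilinear form\<close>

definition monomial_op :: "charge \<Rightarrow> 2 \<Rightarrow> int list \<Rightarrow> fock \<Rightarrow> fock" where
  "monomial_op s a ks = foldr (psi s a) ks"

definition neg_lists :: "int list set" where
  "neg_lists = {ks. sorted_wrt (<) ks \<and> (\<forall>k\<in>set ks. k \<le> -1)}"

text \<open>
  The index consists of the four lists of modes occurring in \<open>M\<^sub>1\<^sup>+\<close>, \<open>M\<^sub>1\<^sup>-\<close>, \<open>M\<^sub>0\<^sup>+\<close>, \<open>M\<^sub>0\<^sup>-\<close>.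
\<close>

type_synonym wedge_index = "int list \<times> int list \<times> int list \<times> int list"

definition wedge_indices :: "wedge_index set" where
  "wedge_indices = neg_lists \<times> neg_lists \<times> neg_lists \<times> neg_lists"

definition elem_wedge :: "wedge_index \<Rightarrow> fock" where
  "elem_wedge = (\<lambda>(p1, n1, p0, n0).
     monomial_op Cre 1 p1 (monomial_op Ann 1 n1
       (monomial_op Cre 0 p0 (monomial_op Ann 0 n0 vac))))"

definition is_wedge_form :: "(fock \<Rightarrow> fock \<Rightarrow> complex) \<Rightarrow> bool" where
  "is_wedge_form B \<longleftrightarrow>
     (\<forall>v. Vector_Spaces.linear fscale (*) (B v)) \<and>
     (\<forall>w. Vector_Spaces.linear fscale (*) (\<lambda>v. B v w)) \<and>
     (\<forall>d\<in>wedge_indices. \<forall>e\<in>wedge_indices.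
        B (elem_wedge d) (elem_wedge e) = (if d = e then 1 else 0))"

text \<open>Well defined by \<open>ex1_wedge_form\<close> below.\<close>

definition wedge_form :: "fock \<Rightarrow> fock \<Rightarrow> complex" where
  "wedge_form = (THE B. is_wedge_form B)"


subsection \<open>Fermionic translation operators\<close>

definition is_translation :: "(2 \<Rightarrow> fock \<Rightarrow> fock) \<Rightarrow> bool" where
  "is_translation Q \<longleftrightarrow>
     (\<forall>a. Vector_Spaces.linear fscale fscale (Q a) \<and> bij (Q a)) \<and>
     (\<forall>a. Q a vac = psi Cre a (-1) vac) \<and>
     (\<forall>s a. (\<lambda>n. psi_field s a n \<circ> Q a) =
             w_times (charge_val s) (\<lambda>n. Q a \<circ> psi_field s a n)) \<and>
     (\<forall>s a b. a \<noteq> b \<longrightarrow> (\<forall>n. psi_field s a n \<circ> Q b = - (Q b \<circ> psi_field s a n))) \<and>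
     (\<forall>a b. a \<noteq> b \<longrightarrow> Q a \<circ> Q b = - (Q b \<circ> Q a))"

text \<open>Well defined by \<open>ex1_translation\<close> below.\<close>

definition Q_op :: "2 \<Rightarrow> fock \<Rightarrow> fock" where
  "Q_op = (THE Q. is_translation Q)"

definition T_op :: "fock \<Rightarrow> fock" where
  "T_op = Q_op 1 \<circ> inv_into UNIV (Q_op 0)"

definition T_power :: "int \<Rightarrow> fock \<Rightarrow> fock" where
  "T_power k = (if 0 \<le> k then T_op ^^ nat k else inv_into UNIV T_op ^^ nat (- k))"


section \<open>Formal series in the variables \<open>c\<^sub>i\<close>\<close>

text \<open>
  A monomial in the \<open>c\<^sub>i\<close> is its finitely supported exponent function. Formal series in the
  \<open>c\<^sub>i\<close> with coefficients in \<open>'x\<close> are arbitrary functions on monomials; the ones with finitely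
  many nonzero complex coefficients form the polynomial ring \<open>cpoly\<close>, embedded by \<open>lookup\<close>.
\<close>

type_synonym cmono = "int \<Rightarrow>\<^sub>0 nat"
type_synonym 'x cser = "cmono \<Rightarrow> 'x"
type_synonym cpoly = "cmono \<Rightarrow>\<^sub>0 complex"

definition ser_of_poly :: "cpoly \<Rightarrow> complex cser" where
  "ser_of_poly p = Poly_Mapping.lookup p"

definition cconst :: "complex \<Rightarrow> cpoly" where
  "cconst z = Poly_Mapping.single 0 z"

definition cvar :: "int \<Rightarrow> cpoly" where
  "cvar i = Poly_Mapping.single (Poly_Mapping.single i 1) 1"

definition C_series :: "int \<Rightarrow> cpoly" where
  "C_series n = cvar (- n - 1)"

definition C_alpha :: "int \<Rightarrow> int \<Rightarrow> cpoly" where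
  "C_alpha \<alpha> = (\<lambda>n. cconst ((-1) powi \<alpha>) * w_times \<alpha> C_series n)"

text \<open>Cauchy product of a polynomial and a Fock-space valued series in the \<open>c\<^sub>i\<close>.\<close>

definition cmult :: "cpoly \<Rightarrow> fock cser \<Rightarrow> fock cser" where
  "cmult p u = (\<lambda>\<mu>. \<Sum>(\<nu>, \<rho>) | \<nu> + \<rho> = \<mu>. fscale (Poly_Mapping.lookup p \<nu>) (u \<rho>))"


section \<open>The \<open>\<tau>\<close>-functions\<close>

text \<open>
  The sums below over all integers, or over all powers, have only finitely many nonzero terms,
  once they are applied to a vector or once the monomial in the \<open>c\<^sub>i\<close> is fixed; see
  \<open>finite_field_mult\<close>, \<open>finite_current\<close> and \<open>finite_exp\<close> below.
\<close>

definition field_mult :: "(int \<Rightarrow> fock \<Rightarrow> fock) \<Rightarrow> (int \<Rightarrow> fock \<Rightarrow> fock) \<Rightarrow> int \<Rightarrow> fock \<Rightarrow> fock" where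
  "field_mult A B n = (\<lambda>v. Sum_any (\<lambda>p. A p (B (n - p) v)))"

definition cfield_mult :: "(int \<Rightarrow> cpoly) \<Rightarrow> (int \<Rightarrow> fock \<Rightarrow> fock) \<Rightarrow> int \<Rightarrow> fock cser \<Rightarrow> fock cser" where
  "cfield_mult D A n = (\<lambda>u \<mu>. Sum_any (\<lambda>p. cmult (D p) (A (n - p) \<circ> u) \<mu>))"

definition current :: "int \<Rightarrow> fock cser \<Rightarrow> fock cser" where
  "current \<alpha> =
     Res (cfield_mult (C_alpha \<alpha>) (field_mult (psi_field Cre 1) (psi_field Ann 0)))"

definition fock_const :: "fock \<Rightarrow> fock cser" where
  "fock_const v = (\<lambda>\<mu>. if \<mu> = 0 then v else 0)"

definition g_op :: "int \<Rightarrow> fock \<Rightarrow> fock cser" where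
  "g_op \<alpha> v = (\<lambda>\<mu>. Sum_any (\<lambda>n::nat. fscale (1 / fact n) ((current \<alpha> ^^ n) (fock_const v) \<mu>)))"

definition tau :: "int \<Rightarrow> int \<Rightarrow> complex cser" where
  "tau k \<alpha> = (\<lambda>\<mu>. wedge_form (T_power k vac) (g_op \<alpha> vac \<mu>))"


section \<open>Series in several variables \<open>w\<^sub>i\<close>\<close>

text \<open>
  Exponents of \<open>w\<^sub>1\<^bsup>m 1\<^esup> w\<^sub>2\<^bsup>m 2\<^esup> \<cdots>\<close> are finitely supported integer functions \<open>m\<close>. Laurent polynomials
  form a ring; series infinite in all directions are functions on exponents, and only a module
  over it.
\<close>

type_synonym wmono = "nat \<Rightarrow>\<^sub>0 int"
type_synonym wpoly = "wmono \<Rightarrow>\<^sub>0 cpoly"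
type_synonym wser = "wmono \<Rightarrow> cpoly"

definition wvar :: "nat \<Rightarrow> wpoly" where
  "wvar i = Poly_Mapping.single (Poly_Mapping.single i 1) 1"

definition wmult :: "wser \<Rightarrow> wpoly \<Rightarrow> wser" where
  "wmult s q = (\<lambda>m. \<Sum>d\<in>Poly_Mapping.keys q. s (m - d) * Poly_Mapping.lookup q d)"

text \<open>The product \<open>D(w\<^sub>1) \<cdots> D(w\<^sub>k)\<close>.\<close>

definition separate_prod :: "nat \<Rightarrow> (int \<Rightarrow> cpoly) \<Rightarrow> wser" where
  "separate_prod k D = (\<lambda>m. if Poly_Mapping.keys m \<subseteq> {1..k}
     then (\<Prod>i = 1..k. D (Poly_Mapping.lookup m i)) else 0)"

text \<open>The coefficient of \<open>w\<^sub>i\<^sup>-\<^sup>1\<close>, a series not involving \<open>w\<^sub>i\<close>.\<close>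

definition Res_var :: "nat \<Rightarrow> wser \<Rightarrow> wser" where
  "Res_var i s = (\<lambda>m. if Poly_Mapping.lookup m i = 0
     then s (m + Poly_Mapping.single i (-1)) else 0)"

text \<open>
  \<open>Res\<^bsub>w\<^sub>1\<^esub> \<cdots> Res\<^bsub>w\<^sub>k\<^esub>\<close> of a series in \<open>w\<^sub>1, \<dots>, w\<^sub>k\<close>: no variable is left, so the value is the
  coefficient at exponent 0.
\<close>

definition Res_all :: "nat \<Rightarrow> wser \<Rightarrow> cpoly" where
  "Res_all k s = foldr Res_var [1..<Suc k] s 0"

definition sq_vandermonde :: "nat \<Rightarrow> wpoly" where
  "sq_vandermonde k = (\<Prod>(i, j) \<in> {(i, j). 1 \<le> i \<and> i < j \<and> j \<le> k}. (wvar i - wvar j) ^ 2)"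


section \<open>Well-definedness\<close>

subsection \<open>The Fock space and the bilinear form\<close>

lemma lookup_fscale [simp]: "Poly_Mapping.lookup (fscale c v) S = c * Poly_Mapping.lookup v S"
  by (simp add: fscale_def Poly_Mapping.map.rep_eq when_def)

interpretation fock: vector_space fscale
  by unfold_locales (auto intro!: poly_mapping_eqI simp: lookup_add algebra_simps)

lemma vector_space_complex: "vector_space ((*) :: complex \<Rightarrow> complex \<Rightarrow> complex)"
  by unfold_locales (auto simp: algebra_simps)

lemma ket_expand: "v = (\<Sum>S\<in>Poly_Mapping.keys v. fscale (Poly_Mapping.lookup v S) (ket S))"
  by (rule poly_mapping_eqI)
    (auto simp: lookup_sum ket_def lookup_single when_def in_keys_iff if_distrib[of "\<lambda>x. _ * x"]
       sum.delta' cong: if_cong)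

lemma lin_ext_superset:
  assumes "finite A" "Poly_Mapping.keys v \<subseteq> A"
  shows "lin_ext f v = (\<Sum>S\<in>A. fscale (Poly_Mapping.lookup v S) (f S))"
  unfolding lin_ext_def using assms
  by (intro sum.mono_neutral_left) (auto simp: in_keys_iff)

lemma linear_lin_ext: "Vector_Spaces.linear fscale fscale (lin_ext f)"
  unfolding Vector_Spaces.linear_iff
proof (intro conjI allI)
  fix v w :: fock
  let ?A = "Poly_Mapping.keys v \<union> Poly_Mapping.keys w"
  have "Poly_Mapping.keys (v + w) \<subseteq> ?A" by (rule Poly_Mapping.keys_add)
  then show "lin_ext f (v + w) = lin_ext f v + lin_ext f w"
    by (subst (1 2 3) lin_ext_superset[of ?A])
      (auto simp: lookup_add fock.scale_left_distrib sum.distrib)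
next
  fix c and v :: fock
  have "Poly_Mapping.keys (fscale c v) \<subseteq> Poly_Mapping.keys v" by (auto simp: in_keys_iff)
  then show "lin_ext f (fscale c v) = fscale c (lin_ext f v)"
    by (subst (1 2) lin_ext_superset[of "Poly_Mapping.keys v"])
      (auto simp: fock.scale_sum_right)
qed (fact fock.vector_space_axioms)+

lemma lin_ext_ket [simp]: "lin_ext f (ket S) = f S"
  by (simp add: lin_ext_def ket_def)

lemma linear_psi: "Vector_Spaces.linear fscale fscale (psi s a k)"
  by (cases s) (auto simp: wedge_def contract_def intro: linear_lin_ext)

lemma linear_eq_on_ket:
  assumes "Vector_Spaces.linear fscale sc A" "Vector_Spaces.linear fscale sc B"
    and "\<And>S. A (ket S) = B (ket S)"
  shows "A = B"
proof
  fix v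
  interpret A: Vector_Spaces.linear fscale sc A by fact
  interpret B: Vector_Spaces.linear fscale sc B by fact
  show "A v = B v"
    by (subst (1 2) ket_expand) (simp add: A.sum B.sum A.scale B.scale assms)
qed

lemma Rep_Abs_maya:
  "finite (X - vac_set) \<Longrightarrow> finite (vac_set - X) \<Longrightarrow> Rep_maya (Abs_maya X) = X"
  by (simp add: Abs_maya_inverse)

lemma finite_Rep_maya: "finite (Rep_maya S - vac_set)" "finite (vac_set - Rep_maya S)"
  using Rep_maya[of S] by auto

definition ket_pm :: "mode set \<Rightarrow> fock \<Rightarrow> bool" where
  "ket_pm X v \<longleftrightarrow> (\<exists>S. Rep_maya S = X \<and> (v = ket S \<or> v = - ket S))"

lemma ket_pm_finite: "ket_pm X v \<Longrightarrow> finite (X - vac_set) \<and> finite (vac_set - X)"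
  using finite_Rep_maya by (auto simp: ket_pm_def)

lemma wedge_sign_cases: "wedge_sign x S = 1 \<or> wedge_sign x S = -1"
  by (simp add: wedge_sign_def) (metis neg_one_even_power neg_one_odd_power)

lemma ket_pm_psi_Cre:
  assumes "ket_pm X v" "(a, k) \<notin> X"
  shows "ket_pm (insert (a, k) X) (psi Cre a k v)"
proof -
  interpret L: Vector_Spaces.linear fscale fscale "psi Cre a k" by (rule linear_psi)
  obtain S where S: "Rep_maya S = X" "v = ket S \<or> v = - ket S"
    using assms(1) unfolding ket_pm_def by blast
  let ?S' = "Abs_maya (insert (a, k) X)"
  have rep: "Rep_maya ?S' = insert (a, k) X"
  proof (intro Rep_Abs_maya)
    have "insert (a, k) X - vac_set \<subseteq> insert (a, k) (X - vac_set)" by auto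
    then show "finite (insert (a, k) X - vac_set)"
      using ket_pm_finite[OF assms(1)] finite_subset by auto
    show "finite (vac_set - insert (a, k) X)"
      using ket_pm_finite[OF assms(1)] by (auto intro: finite_subset[of _ "vac_set - X"])
  qed
  have "psi Cre a k (ket S) = fscale (wedge_sign (a, k) S) (ket ?S')"
    using S assms by (simp add: wedge_def)
  then have "psi Cre a k v = ket ?S' \<or> psi Cre a k v = - ket ?S'"
    using S(2) wedge_sign_cases[of "(a, k)" S] L.neg[of "ket S"]
    by (elim disjE) (simp_all del: psi.simps)
  with rep show ?thesis unfolding ket_pm_def by blast
qed

lemma ket_pm_psi_Ann:
  assumes "ket_pm X v" "(a, - k - 1) \<in> X"
  shows "ket_pm (X - {(a, - k - 1)}) (psi Ann a k v)"
proof -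
  interpret L: Vector_Spaces.linear fscale fscale "psi Ann a k" by (rule linear_psi)
  obtain S where S: "Rep_maya S = X" "v = ket S \<or> v = - ket S"
    using assms(1) unfolding ket_pm_def by blast
  let ?S' = "Abs_maya (X - {(a, - k - 1)})"
  have rep: "Rep_maya ?S' = X - {(a, - k - 1)}"
  proof (intro Rep_Abs_maya)
    show "finite (X - {(a, - k - 1)} - vac_set)"
      using ket_pm_finite[OF assms(1)] by (auto intro: finite_subset[of _ "X - vac_set"])
    have "vac_set - (X - {(a, - k - 1)}) \<subseteq> insert (a, - k - 1) (vac_set - X)" by auto
    then show "finite (vac_set - (X - {(a, - k - 1)}))"
      using ket_pm_finite[OF assms(1)] finite_subset by auto
  qed
  have "psi Ann a k (ket S) = fscale (wedge_sign (a, - k - 1) S) (ket ?S')"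
    using S assms by (simp add: contract_def)
  then have "psi Ann a k v = ket ?S' \<or> psi Ann a k v = - ket ?S'"
    using S(2) wedge_sign_cases[of "(a, - k - 1)" S] L.neg[of "ket S"]
    by (elim disjE) (simp_all del: psi.simps)
  with rep show ?thesis unfolding ket_pm_def by blast
qed

lemma ket_pm_vac: "ket_pm vac_set vac"
  by (auto simp: ket_pm_def vac_def Rep_Abs_maya intro!: exI[of _ "Abs_maya vac_set"])

lemma ket_pm_monomial_Cre:
  assumes "ket_pm X v" "distinct ks" "\<And>k. k \<in> set ks \<Longrightarrow> (a, k) \<notin> X"
  shows "ket_pm (X \<union> Pair a ` set ks) (monomial_op Cre a ks v)"
  using assms(2,3)
proof (induction ks)
  case Nil
  then show ?case using assms(1) by (simp add: monomial_op_def)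
next
  case (Cons k ks)
  then have "ket_pm (insert (a, k) (X \<union> Pair a ` set ks)) (psi Cre a k (monomial_op Cre a ks v))"
    by (intro ket_pm_psi_Cre) auto
  then show ?case by (simp add: monomial_op_def del: psi.simps)
qed

lemma ket_pm_monomial_Ann:
  assumes "ket_pm X v" "distinct ks" "\<And>k. k \<in> set ks \<Longrightarrow> (a, - k - 1) \<in> X"
  shows "ket_pm (X - (\<lambda>k. (a, - k - 1)) ` set ks) (monomial_op Ann a ks v)"
  using assms(2,3)
proof (induction ks)
  case Nil
  then show ?case using assms(1) by (simp add: monomial_op_def)
next
  case (Cons k ks)
  have "ket_pm (X - (\<lambda>k. (a, - k - 1)) ` set ks) (monomial_op Ann a ks v)"
    using Cons by simp
  moreover have "(a, - k - 1) \<in> X - (\<lambda>k. (a, - k - 1)) ` set ks"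
    using Cons.prems by (simp add: image_iff)
  ultimately have "ket_pm (X - (\<lambda>k. (a, - k - 1)) ` set ks - {(a, - k - 1)})
     (psi Ann a k (monomial_op Ann a ks v))"
    by (rule ket_pm_psi_Ann)
  moreover have "X - (\<lambda>k. (a, - k - 1)) ` set ks - {(a, - k - 1)}
     = X - (\<lambda>k. (a, - k - 1)) ` set (k # ks)" by auto
  ultimately show ?case by (simp add: monomial_op_def del: psi.simps)
qed

definition index_set :: "wedge_index \<Rightarrow> mode set" where
  "index_set = (\<lambda>(p1, n1, p0, n0).
     ((vac_set - (\<lambda>k. (0, - k - 1)) ` set n0 \<union> Pair 0 ` set p0)
        - (\<lambda>k. (1, - k - 1)) ` set n1) \<union> Pair 1 ` set p1)"

lemma neg_lists_D: "ks \<in> neg_lists \<Longrightarrow> distinct ks" "ks \<in> neg_lists \<Longrightarrow> k \<in> set ks \<Longrightarrow> k < 0"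
  by (auto simp: neg_lists_def strict_sorted_iff)

lemma ket_pm_elem_wedge:
  assumes "d \<in> wedge_indices"
  shows "ket_pm (index_set d) (elem_wedge d)"
proof -
  obtain p1 n1 p0 n0 where d: "d = (p1, n1, p0, n0)" by (cases d) auto
  then have *: "p1 \<in> neg_lists" "n1 \<in> neg_lists" "p0 \<in> neg_lists" "n0 \<in> neg_lists"
    using assms by (auto simp: wedge_indices_def)
  note D = *[THEN neg_lists_D(1)] and N = *[THEN neg_lists_D(2)]
  let ?X1 = "vac_set - (\<lambda>k. (0, - k - 1)) ` set n0"
  let ?X2 = "?X1 \<union> Pair 0 ` set p0"
  let ?X3 = "?X2 - (\<lambda>k. (1, - k - 1)) ` set n1"
  have "ket_pm ?X1 (monomial_op Ann 0 n0 vac)"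
    by (rule ket_pm_monomial_Ann[OF ket_pm_vac D(4)]) (use N(4) in \<open>force simp: vac_set_def\<close>)
  then have "ket_pm ?X2 (monomial_op Cre 0 p0 (monomial_op Ann 0 n0 vac))"
    by (rule ket_pm_monomial_Cre[OF _ D(3)]) (use N(3) in \<open>force simp: vac_set_def\<close>)
  then have "ket_pm ?X3 (monomial_op Ann 1 n1 (monomial_op Cre 0 p0 (monomial_op Ann 0 n0 vac)))"
    by (rule ket_pm_monomial_Ann[OF _ D(2)]) (use N(2) in \<open>force simp: vac_set_def\<close>)
  then have "ket_pm (?X3 \<union> Pair 1 ` set p1)
    (monomial_op Cre 1 p1 (monomial_op Ann 1 n1 (monomial_op Cre 0 p0 (monomial_op Ann 0 n0 vac))))"
    by (rule ket_pm_monomial_Cre[OF _ D(1)]) (use N(1) in \<open>force simp: vac_set_def\<close>)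
  then show ?thesis by (simp add: d index_set_def elem_wedge_def)
qed

lemma in_index_set:
  assumes "(p1, n1, p0, n0) \<in> wedge_indices"
  shows "(0, k) \<in> index_set (p1, n1, p0, n0) \<longleftrightarrow> (if k < 0 then k \<in> set p0 else - k - 1 \<notin> set n0)"
    and "(1, k) \<in> index_set (p1, n1, p0, n0) \<longleftrightarrow> (if k < 0 then k \<in> set p1 else - k - 1 \<notin> set n1)"
proof -
  have *: "p1 \<in> neg_lists" "n1 \<in> neg_lists" "p0 \<in> neg_lists" "n0 \<in> neg_lists"
    using assms by (auto simp: wedge_indices_def)
  note N = *[THEN neg_lists_D(2)]
  have eqv: "k = - j - 1 \<longleftrightarrow> j = - k - 1" for j k :: int by auto
  show "(0, k) \<in> index_set (p1, n1, p0, n0) \<longleftrightarrow> (if k < 0 then k \<in> set p0 else - k - 1 \<notin> set n0)"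
    using N(1,2)[of k] N(3,4)[of k] N(2,4)[of "- k - 1"] eqv[of k]
    by (auto simp: index_set_def vac_set_def image_iff)
  show "(1, k) \<in> index_set (p1, n1, p0, n0) \<longleftrightarrow> (if k < 0 then k \<in> set p1 else - k - 1 \<notin> set n1)"
    using N(1,2)[of k] N(3,4)[of k] N(2,4)[of "- k - 1"] eqv[of k]
    by (auto simp: index_set_def vac_set_def image_iff)
qed

lemma neg_lists_eq:
  assumes "xs \<in> neg_lists" "ys \<in> neg_lists" "\<And>k. k < 0 \<Longrightarrow> k \<in> set xs \<longleftrightarrow> k \<in> set ys"
  shows "xs = ys"
proof -
  have "set xs = set ys" using assms neg_lists_D(2) by blast
  then show ?thesis using assms by (auto simp: neg_lists_def intro: strict_sorted_equal)
qed

lemma inj_index_set: "inj_on index_set wedge_indices"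
proof (rule inj_onI)
  fix d e assume d: "d \<in> wedge_indices" and e: "e \<in> wedge_indices" and eq: "index_set d = index_set e"
  obtain p1 n1 p0 n0 where [simp]: "d = (p1, n1, p0, n0)" by (cases d) auto
  obtain q1 m1 q0 m0 where [simp]: "e = (q1, m1, q0, m0)" by (cases e) auto
  have 0: "(if k < 0 then k \<in> set p0 else - k - 1 \<notin> set n0) = (if k < 0 then k \<in> set q0 else - k - 1 \<notin> set m0)"
    and 1: "(if k < 0 then k \<in> set p1 else - k - 1 \<notin> set n1) = (if k < 0 then k \<in> set q1 else - k - 1 \<notin> set m1)" for k
    using in_index_set[of p1 n1 p0 n0 k] in_index_set[of q1 m1 q0 m0 k] d e eq by simp_all
  have *: "p1 \<in> neg_lists" "n1 \<in> neg_lists" "p0 \<in> neg_lists" "n0 \<in> neg_lists"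
    "q1 \<in> neg_lists" "m1 \<in> neg_lists" "q0 \<in> neg_lists" "m0 \<in> neg_lists"
    using d e by (auto simp: wedge_indices_def)
  have "p0 = q0" using * 0 by (intro neg_lists_eq) (metis)+
  moreover have "p1 = q1" using * 1 by (intro neg_lists_eq) (metis)+
  moreover have "n0 = m0"
  proof (intro neg_lists_eq *)
    fix k :: int assume "k < 0" then show "k \<in> set n0 \<longleftrightarrow> k \<in> set m0" using 0[of "- k - 1"] by simp
  qed
  moreover have "n1 = m1"
  proof (intro neg_lists_eq *)
    fix k :: int assume "k < 0" then show "k \<in> set n1 \<longleftrightarrow> k \<in> set m1" using 1[of "- k - 1"] by simp
  qed
  ultimately show "d = e" by simp
qed

lemma two_cases: "(a::2) = 0 \<or> a = 1"
proof (cases a)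
  case (of_int z)
  then have "z = 0 \<or> z = 1" by auto
  then show ?thesis using of_int by auto
qed

lemma index_set_surj: "\<exists>d\<in>wedge_indices. index_set d = Rep_maya S"
proof -
  define X where "X = Rep_maya S"
  have fin: "finite (X - vac_set)" "finite (vac_set - X)" unfolding X_def by (rule finite_Rep_maya)+
  define P where "P a = sorted_list_of_set {k. k < 0 \<and> (a, k) \<in> X}" for a
  define N where "N a = sorted_list_of_set {k. k < 0 \<and> (a, - k - 1) \<notin> X}" for a
  have "{k. k < 0 \<and> (a, k) \<in> X} \<subseteq> snd ` (X - vac_set)" for a
    by (force simp: vac_set_def image_iff)
  then have fP: "finite {k. k < 0 \<and> (a, k) \<in> X}" for a using fin finite_subset by blast
  have "{k. k < 0 \<and> (a, - k - 1) \<notin> X} \<subseteq> (\<lambda>x. - snd x - 1) ` (vac_set - X)" for a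
    by (force simp: vac_set_def image_iff)
  then have fN: "finite {k. k < 0 \<and> (a, - k - 1) \<notin> X}" for a using fin finite_subset by blast
  have mem: "P a \<in> neg_lists" "N a \<in> neg_lists" for a
    using fP[of a] fN[of a] by (auto simp: P_def N_def neg_lists_def)
  let ?d = "(P 1, N 1, P 0, N 0)"
  have d: "?d \<in> wedge_indices" using mem by (simp add: wedge_indices_def)
  have "(a, k) \<in> index_set ?d \<longleftrightarrow> (a, k) \<in> X" for a k
  proof -
    have "set (P b) = {k. k < 0 \<and> (b, k) \<in> X}" "set (N b) = {k. k < 0 \<and> (b, - k - 1) \<notin> X}" for b
      using fP fN by (simp_all add: P_def N_def)
    then have "(0, k) \<in> index_set ?d \<longleftrightarrow> (0, k) \<in> X" "(1, k) \<in> index_set ?d \<longleftrightarrow> (1, k) \<in> X"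
      unfolding in_index_set[OF d] by simp_all
    then show ?thesis using two_cases[of a] by auto
  qed
  then have "index_set ?d = X" by auto
  with d show ?thesis unfolding X_def by blast
qed

lemma ket_elem_wedge: "\<exists>d\<in>wedge_indices. elem_wedge d = ket S \<or> elem_wedge d = - ket S"
proof -
  obtain d where d: "d \<in> wedge_indices" "index_set d = Rep_maya S" using index_set_surj by blast
  then have "ket_pm (Rep_maya S) (elem_wedge d)" using ket_pm_elem_wedge by metis
  then show ?thesis using d by (auto simp: ket_pm_def Rep_maya_inject)
qed

inductive_set words :: "fock set" where
  vac: "vac \<in> words"
| psi: "v \<in> words \<Longrightarrow> psi s a k v \<in> words"

lemma monomial_words: "v \<in> words \<Longrightarrow> monomial_op s a ks v \<in> words"
  by (induction ks) (auto simp: monomial_op_def intro: words.intros)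

theorem fock_generated: "fock.span words = UNIV"
proof -
  have "ket S \<in> fock.span words" for S
  proof -
    obtain d where "elem_wedge d = ket S \<or> elem_wedge d = - ket S" using ket_elem_wedge by blast
    moreover have "elem_wedge d \<in> words"
      by (auto simp: elem_wedge_def split: prod.split intro!: monomial_words words.vac)
    then have "elem_wedge d \<in> fock.span words" by (rule fock.span_base)
    ultimately show ?thesis using fock.span_neg[of "elem_wedge d"] by auto
  qed
  then have "v \<in> fock.span words" for v
    by (subst ket_expand) (intro fock.span_sum fock.span_scale)
  then show ?thesis by auto
qed

definition coord_form :: "fock \<Rightarrow> fock \<Rightarrow> complex" where
  "coord_form v w = (\<Sum>S\<in>Poly_Mapping.keys v. Poly_Mapping.lookup v S * Poly_Mapping.lookup w S)"

lemma coord_form_superset: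
  assumes "finite A" "Poly_Mapping.keys v \<subseteq> A"
  shows "coord_form v w = (\<Sum>S\<in>A. Poly_Mapping.lookup v S * Poly_Mapping.lookup w S)"
  unfolding coord_form_def using assms
  by (intro sum.mono_neutral_left) (auto simp: in_keys_iff)

lemma linear_coord_form:
  "Vector_Spaces.linear fscale (*) (coord_form v)"
  "Vector_Spaces.linear fscale (*) (\<lambda>v. coord_form v w)"
proof -
  show "Vector_Spaces.linear fscale (*) (coord_form v)"
    by (auto simp: Vector_Spaces.linear_iff vector_space_complex fock.vector_space_axioms
      coord_form_def lookup_add algebra_simps sum.distrib sum_distrib_left)
  show "Vector_Spaces.linear fscale (*) (\<lambda>v. coord_form v w)"
    unfolding Vector_Spaces.linear_iff
  proof (intro conjI allI)
    fix v u :: fock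
    let ?A = "Poly_Mapping.keys v \<union> Poly_Mapping.keys u"
    have "Poly_Mapping.keys (v + u) \<subseteq> ?A" by (rule Poly_Mapping.keys_add)
    then show "coord_form (v + u) w = coord_form v w + coord_form u w"
      by (subst (1 2 3) coord_form_superset[of ?A]) (auto simp: lookup_add algebra_simps sum.distrib)
  next
    fix c and v :: fock
    have "Poly_Mapping.keys (fscale c v) \<subseteq> Poly_Mapping.keys v" by (auto simp: in_keys_iff)
    then show "coord_form (fscale c v) w = c * coord_form v w"
      by (subst (1 2) coord_form_superset[of "Poly_Mapping.keys v"]) (auto simp: sum_distrib_left mult.assoc)
  qed (fact fock.vector_space_axioms vector_space_complex)+
qed

lemma coord_form_ket: "coord_form (ket S) (ket S') = (if S = S' then 1 else 0)"
  by (simp add: coord_form_def ket_def lookup_single when_def)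

lemma coord_form_neg: "coord_form (- v) w = - coord_form v w" "coord_form v (- w) = - coord_form v w"
  by (simp_all add: coord_form_def sum_negf)

lemma is_wedge_form_coord_form: "is_wedge_form coord_form"
  unfolding is_wedge_form_def
proof (intro conjI allI ballI linear_coord_form)
  fix d e assume d: "d \<in> wedge_indices" and e: "e \<in> wedge_indices"
  obtain S where S: "Rep_maya S = index_set d" "elem_wedge d = ket S \<or> elem_wedge d = - ket S"
    using ket_pm_elem_wedge[OF d] by (auto simp: ket_pm_def)
  obtain S' where S': "Rep_maya S' = index_set e" "elem_wedge e = ket S' \<or> elem_wedge e = - ket S'"
    using ket_pm_elem_wedge[OF e] by (auto simp: ket_pm_def)
  show "coord_form (elem_wedge d) (elem_wedge e) = (if d = e then 1 else 0)"
  proof (cases "d = e")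
    case True
    then show ?thesis using S by (auto simp: coord_form_neg coord_form_ket)
  next
    case False
    then have "S \<noteq> S'" using S S' d e inj_index_set by (metis inj_onD)
    then show ?thesis using S S' False by (auto simp: coord_form_neg coord_form_ket)
  qed
qed

lemma wedge_form_unique:
  assumes "is_wedge_form B" "is_wedge_form B'"
  shows "B = B'"
proof -
  have L: "Vector_Spaces.linear fscale (*) (B v)" "Vector_Spaces.linear fscale (*) (\<lambda>v. B v w)"
    "Vector_Spaces.linear fscale (*) (B' v)" "Vector_Spaces.linear fscale (*) (\<lambda>v. B' v w)" for v w
    using assms by (auto simp: is_wedge_form_def)
  have neg: "B (- v) w = - B v w" "B v (- w) = - B v w" "B' (- v) w = - B' v w" "B' v (- w) = - B' v w" for v w
    using L[unfolded Vector_Spaces.linear_def, THEN conjunct2, THEN conjunct2, THEN module_hom.neg] by blast+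
  have kk: "B (ket S) (ket S') = B' (ket S) (ket S')" for S S'
  proof -
    obtain d where d: "d \<in> wedge_indices" "elem_wedge d = ket S \<or> elem_wedge d = - ket S"
      using ket_elem_wedge by blast
    obtain e where e: "e \<in> wedge_indices" "elem_wedge e = ket S' \<or> elem_wedge e = - ket S'"
      using ket_elem_wedge by blast
    have "B (elem_wedge d) (elem_wedge e) = B' (elem_wedge d) (elem_wedge e)"
      using assms d e by (auto simp: is_wedge_form_def)
    then show ?thesis using d e by (auto simp: neg)
  qed
  have "B (ket S) = B' (ket S)" for S by (rule linear_eq_on_ket[OF L(1) L(3) kk])
  then have "(\<lambda>v. B v w) = (\<lambda>v. B' v w)" for w by (intro linear_eq_on_ket[OF L(2) L(4)]) simp
  then show "B = B'" by (auto simp: fun_eq_iff)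
qed

theorem ex1_wedge_form: "\<exists>!B. is_wedge_form B"
  using is_wedge_form_coord_form wedge_form_unique by blast

lemma wedge_form_eq: "wedge_form = coord_form"
  unfolding wedge_form_def using is_wedge_form_coord_form wedge_form_unique by (blast intro: the_equality)


subsection \<open>Fermions and translation operators\<close>

lemma words_linear_eq:
  assumes L: "Vector_Spaces.linear fscale fscale L" "Vector_Spaces.linear fscale fscale L'"
    and vac: "L vac = L' vac"
    and step: "\<And>s a k v. L v = L' v \<Longrightarrow> L (psi s a k v) = L' (psi s a k v)"
  shows "L = L'"
proof
  fix v
  have "L u = L' u" if "u \<in> words" for u
    using that by induction (auto intro: vac step)
  then show "L v = L' v"
    using fock_generated
    by (intro vector_space_pair.linear_eq_on[of fscale fscale L L' v words] L)
      (auto simp: vector_space_pair_def fock.vector_space_axioms)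
qed

lemma translation_unique:
  assumes "is_translation P" "is_translation P'"
  shows "P = P'"
proof
  fix a
  have rel: "P a (psi s b k v) = (if b = a then psi s b (k - charge_val s) (P a v) else - psi s b k (P a v))"
    if "is_translation P" for P s b k v
  proof (cases "b = a")
    case True
    have "(\<lambda>n. psi_field s a n \<circ> P a) = w_times (charge_val s) (\<lambda>n. P a \<circ> psi_field s a n)"
      using that by (auto simp: is_translation_def)
    from fun_cong[OF fun_cong[OF this, of "charge_val s - k - 1"], of v]
    show ?thesis using True by (simp add: psi_field_def w_times_def algebra_simps del: psi.simps)
  next
    case False
    then have "psi_field s b (- k - 1) \<circ> P a = - (P a \<circ> psi_field s b (- k - 1))"
      using that by (auto simp: is_translation_def)
    from fun_cong[OF this, of v] show ?thesis
      using False by (simp add: psi_field_def del: psi.simps)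
  qed
  show "P a = P' a"
  proof (rule words_linear_eq)
    show "Vector_Spaces.linear fscale fscale (P a)" "Vector_Spaces.linear fscale fscale (P' a)"
      "P a vac = P' a vac"
      using assms by (auto simp: is_translation_def simp del: psi.simps)
  next
    fix s b k v assume "P a v = P' a v"
    then show "P a (psi s b k v) = P' a (psi s b k v)"
      by (simp add: rel[OF assms(1)] rel[OF assms(2)] del: psi.simps)
  qed
qed

definition sh :: "2 \<Rightarrow> mode \<Rightarrow> mode" where
  "sh a x = (if fst x = a then (a, snd x - 1) else x)"

definition shset :: "2 \<Rightarrow> mode set \<Rightarrow> mode set" where
  "shset a X = sh a ` X"

definition raw_sign :: "mode \<Rightarrow> mode set \<Rightarrow> complex" where
  "raw_sign x X = (-1) ^ card {y \<in> X. pos y < pos x}"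

text \<open>The translation operators move wedges by \<open>sh\<close>, up to the sign \<open>eps\<close>.\<close>

definition eps_set :: "2 \<Rightarrow> mode set \<Rightarrow> int set" where
  "eps_set a X = {j. if a = 0 then (1, j) \<in> X \<and> (0, j + 1) \<notin> X else (0, j) \<in> X \<and> (1, j) \<notin> X}"

definition eps :: "2 \<Rightarrow> mode set \<Rightarrow> complex" where
  "eps a X = (-1) ^ card (eps_set a X)"

definition good :: "mode set \<Rightarrow> bool" where
  "good X \<longleftrightarrow> finite (X - vac_set) \<and> finite (vac_set - X)"

lemma good_Rep [simp]: "good (Rep_maya S)"
  using finite_Rep_maya by (simp add: good_def)

lemma good_Rep_Abs [simp]: "good X \<Longrightarrow> Rep_maya (Abs_maya X) = X"
  by (simp add: good_def Rep_Abs_maya)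

lemma wedge_sign_raw: "wedge_sign x S = raw_sign x (Rep_maya S)"
  by (simp add: wedge_sign_def raw_sign_def)

lemma good_finite_diff:
  assumes "good X" "finite (X - Y)" "finite (Y - X)"
  shows "good Y"
proof -
  have "Y - vac_set \<subseteq> (X - vac_set) \<union> (Y - X)" "vac_set - Y \<subseteq> (vac_set - X) \<union> (X - Y)" by auto
  then show ?thesis using assms unfolding good_def by (meson finite_UnI finite_subset)
qed

lemma good_insert [simp]: "good X \<Longrightarrow> good (insert x X)"
  by (erule good_finite_diff) (auto intro: finite_subset[of _ "{x}"])

lemma good_remove [simp]: "good X \<Longrightarrow> good (X - {x})"
  by (erule good_finite_diff) (auto intro: finite_subset[of _ "{x}"])

lemma inj_sh: "inj (sh a)"
  by (auto simp: inj_def sh_def prod_eq_iff split: if_splits)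

lemma mem_shset: "(b, k) \<in> shset a X \<longleftrightarrow> (if b = a then (b, k + 1) \<in> X else (b, k) \<in> X)"
proof -
  have "(b, k) = sh a (if b = a then (b, k + 1) else (b, k))" by (simp add: sh_def)
  then show ?thesis using inj_image_mem_iff[OF inj_sh, of a "if b = a then (b, k + 1) else (b, k)" X]
    unfolding shset_def by (simp split: if_splits)
qed

lemma finite_below:
  assumes "good X"
  shows "finite {y \<in> X. pos y < c}"
proof (rule finite_subset)
  show "{y \<in> X. pos y < c} \<subseteq> (X - vac_set) \<union> (UNIV \<times> {0..c})"
    by (auto simp: vac_set_def pos_def split: if_splits)
  show "finite ((X - vac_set) \<union> (UNIV \<times> {0..c}))"
    using assms by (auto simp: good_def)
qed

lemma good_vac [simp]: "good vac_set" by (simp add: good_def)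

lemma shset_vac: "shset a vac_set = insert (a, -1) vac_set"
  by (auto simp: mem_shset vac_set_def split: if_splits)

lemma good_shset [simp]:
  assumes "good X"
  shows "good (shset a X)"
proof (rule good_finite_diff[of "shset a vac_set"])
  show "good (shset a vac_set)" by (simp add: shset_vac)
  have "shset a vac_set - shset a X = shset a (vac_set - X)" "shset a X - shset a vac_set = shset a (X - vac_set)"
    unfolding shset_def by (simp_all add: image_set_diff[OF inj_sh])
  then show "finite (shset a vac_set - shset a X)" "finite (shset a X - shset a vac_set)"
    using assms by (auto simp: good_def shset_def)
qed

lemma finite_eps_set:
  assumes "good X"
  shows "finite (eps_set a X)"
proof (rule finite_subset)
  show "eps_set a X \<subseteq> snd ` (X - vac_set) \<union> (\<lambda>x. snd x - 1) ` (vac_set - X) \<union> snd ` (vac_set - X)"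
  proof
    fix j assume j: "j \<in> eps_set a X"
    consider "a = 0" "j < 0" | "a = 0" "0 \<le> j" | "a \<noteq> 0" "j < 0" | "a \<noteq> 0" "0 \<le> j" by linarith
    then show "j \<in> snd ` (X - vac_set) \<union> (\<lambda>x. snd x - 1) ` (vac_set - X) \<union> snd ` (vac_set - X)"
    proof cases
      case 1
      then have "(1, j) \<in> X - vac_set" using j by (auto simp: eps_set_def vac_set_def)
      then show ?thesis by (force simp: image_iff)
    next
      case 2
      then have "(0, j + 1) \<in> vac_set - X" using j by (auto simp: eps_set_def vac_set_def)
      then have "(\<lambda>x. snd x - 1) (0::2, j + 1) \<in> (\<lambda>x. snd x - 1) ` (vac_set - X)" by (rule imageI)
      then show ?thesis by simp
    next
      case 3
      then have "(0, j) \<in> X - vac_set" using j by (auto simp: eps_set_def vac_set_def)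
      then show ?thesis by (force simp: image_iff)
    next
      case 4
      then have "(1, j) \<in> vac_set - X" using j by (auto simp: eps_set_def vac_set_def)
      then show ?thesis by (force simp: image_iff)
    qed
  qed
  show "finite (snd ` (X - vac_set) \<union> (\<lambda>x. snd x - 1) ` (vac_set - X) \<union> snd ` (vac_set - X))"
    using assms by (auto simp: good_def)
qed

lemma raw_sign_shset:
  "raw_sign (sh a x) (shset a X) = (-1) ^ card {y \<in> X. pos (sh a y) < pos (sh a x)}"
proof -
  have "{y \<in> shset a X. pos y < pos (sh a x)} = sh a ` {y \<in> X. pos (sh a y) < pos (sh a x)}"
    by (auto simp: shset_def)
  then show ?thesis unfolding raw_sign_def
    by (simp add: card_image[OF inj_on_subset[OF inj_sh subset_UNIV]])
qed

lemma pow_card_insert: "finite A \<Longrightarrow> (-1) ^ card (insert z A) = (if z \<in> A then 1 else -1) * (-1 :: complex) ^ card A"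
  by (simp add: insert_absorb)

lemma sign_key:
  assumes X: "good X" and x: "x \<notin> X"
  shows "raw_sign (sh a x) (shset a X) * eps a X =
    (if fst x = a then 1 else -1) * (eps a (insert x X) * raw_sign x X)"
proof -
  obtain b k where bk: "x = (b, k)" by (cases x)
  let ?A = "{y \<in> X. pos (sh a y) < pos (sh a x)}"
  let ?B = "{y \<in> X. pos y < pos x}"
  let ?E = "eps_set a X" and ?F = "eps_set a (insert x X)"
  have fB: "finite ?B" using X by (rule finite_below)
  have "finite {y \<in> shset a X. pos y < pos (sh a x)}" using X by (intro finite_below) simp
  moreover have "{y \<in> shset a X. pos y < pos (sh a x)} = sh a ` ?A" by (auto simp: shset_def)
  ultimately have fA: "finite ?A" by (simp add: finite_image_iff inj_on_subset[OF inj_sh])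
  have fE: "finite ?E" "finite ?F" using X by (simp_all add: finite_eps_set)
  consider "a = 0" "b = 0" | "a = 0" "b = 1" | "a = 1" "b = 1" | "a = 1" "b = 0"
    using two_cases[of a] two_cases[of b] by auto
  then have "(-1) ^ card ?A * (-1) ^ card ?E =
    (if fst x = a then 1 else -1) * ((-1) ^ card ?F * (-1 :: complex) ^ card ?B)"
  proof cases
    case 1
    have sub: "y \<in> ?B \<longleftrightarrow> y \<in> ?A \<or> (y = (1, k - 1) \<and> y \<in> X)" for y
      using two_cases[of "fst y"] 1 by (cases y) (auto simp: sh_def pos_def bk)
    have E: "j \<in> ?E \<longleftrightarrow> j \<in> ?F \<or> (j = k - 1 \<and> (1, k - 1) \<in> X)" for j
      using 1 x by (auto simp: eps_set_def bk)
    show ?thesis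
    proof (cases "(1, k - 1) \<in> X")
      case True
      have "?B = insert (1, k - 1) ?A" using sub True by blast
      moreover have "?E = insert (k - 1) ?F" using E True by blast
      moreover have "(1, k - 1) \<notin> ?A" "k - 1 \<notin> ?F" using 1 by (auto simp: sh_def pos_def bk eps_set_def)
      ultimately show ?thesis using fA fE 1 bk by (simp add: pow_card_insert)
    next
      case False
      have "?B = ?A" using sub False by blast
      moreover have "?E = ?F" using E False by blast
      ultimately show ?thesis using 1 bk by simp
    qed
  next
    case 2
    have sub: "y \<in> ?A \<longleftrightarrow> y \<in> ?B \<or> (y = (0, k + 1) \<and> y \<in> X)" for y
      using two_cases[of "fst y"] 2 by (cases y) (auto simp: sh_def pos_def bk)
    have E: "j \<in> ?F \<longleftrightarrow> j \<in> ?E \<or> (j = k \<and> (0, k + 1) \<notin> X)" for j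
      using 2 x by (auto simp: eps_set_def bk)
    show ?thesis
    proof (cases "(0, k + 1) \<in> X")
      case True
      have "?A = insert (0, k + 1) ?B" using sub True by blast
      moreover have "?E = ?F" using E True by blast
      moreover have "(0, k + 1) \<notin> ?B" using 2 by (auto simp: pos_def bk)
      ultimately show ?thesis using fB fE 2 bk by (simp add: pow_card_insert)
    next
      case False
      have "?A = ?B" using sub False by blast
      moreover have "?F = insert k ?E" using E False by blast
      moreover have "k \<notin> ?E" using 2 x by (auto simp: eps_set_def bk)
      ultimately show ?thesis using fE 2 bk by (simp add: pow_card_insert)
    qed
  next
    case 3
    have sub: "y \<in> ?B \<longleftrightarrow> y \<in> ?A \<or> (y = (0, k) \<and> y \<in> X)" for y
      using two_cases[of "fst y"] 3 by (cases y) (auto simp: sh_def pos_def bk)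
    have E: "j \<in> ?E \<longleftrightarrow> j \<in> ?F \<or> (j = k \<and> (0, k) \<in> X)" for j
      using 3 x by (auto simp: eps_set_def bk)
    show ?thesis
    proof (cases "(0, k) \<in> X")
      case True
      have "?B = insert (0, k) ?A" using sub True by blast
      moreover have "?E = insert k ?F" using E True by blast
      moreover have "(0, k) \<notin> ?A" "k \<notin> ?F" using 3 by (auto simp: sh_def pos_def bk eps_set_def)
      ultimately show ?thesis using fA fE 3 bk by (simp add: pow_card_insert)
    next
      case False
      have "?B = ?A" using sub False by blast
      moreover have "?E = ?F" using E False by blast
      ultimately show ?thesis using 3 bk by simp
    qed
  next
    case 4
    have sub: "y \<in> ?A \<longleftrightarrow> y \<in> ?B \<or> (y = (1, k) \<and> y \<in> X)" for y
      using two_cases[of "fst y"] 4 by (cases y) (auto simp: sh_def pos_def bk)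
    have E: "j \<in> ?F \<longleftrightarrow> j \<in> ?E \<or> (j = k \<and> (1, k) \<notin> X)" for j
      using 4 x by (auto simp: eps_set_def bk)
    show ?thesis
    proof (cases "(1, k) \<in> X")
      case True
      have "?A = insert (1, k) ?B" using sub True by blast
      moreover have "?E = ?F" using E True by blast
      moreover have "(1, k) \<notin> ?B" using 4 by (auto simp: pos_def bk)
      ultimately show ?thesis using fB fE 4 bk by (simp add: pow_card_insert)
    next
      case False
      have "?A = ?B" using sub False by blast
      moreover have "?F = insert k ?E" using E False by blast
      moreover have "k \<notin> ?E" using 4 x by (auto simp: eps_set_def bk)
      ultimately show ?thesis using fE 4 bk by (simp add: pow_card_insert)
    qed
  qed
  then show ?thesis by (simp only: raw_sign_shset eps_def raw_sign_def[of x X])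
qed

definition shift_op :: "2 \<Rightarrow> fock \<Rightarrow> fock" where
  "shift_op a = lin_ext (\<lambda>S. fscale (eps a (Rep_maya S)) (ket (Abs_maya (shset a (Rep_maya S)))))"

lemma linear_shift_op: "Vector_Spaces.linear fscale fscale (shift_op a)"
  unfolding shift_op_def by (rule linear_lin_ext)

lemma linear_wedge: "Vector_Spaces.linear fscale fscale (wedge x)"
  and linear_contract: "Vector_Spaces.linear fscale fscale (contract x)"
  unfolding wedge_def contract_def by (rule linear_lin_ext)+

lemma linear_fscale_comp:
  "Vector_Spaces.linear fscale fscale L \<Longrightarrow> Vector_Spaces.linear fscale fscale (\<lambda>v. fscale c (L v))"
  by (auto simp: Vector_Spaces.linear_iff fock.scale_right_distrib)

lemma linear_comp:
  "Vector_Spaces.linear fscale fscale L \<Longrightarrow> Vector_Spaces.linear fscale fscale M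
     \<Longrightarrow> Vector_Spaces.linear fscale fscale (\<lambda>v. L (M v))"
  by (auto simp: Vector_Spaces.linear_iff)

lemma linear_zero_scale:
  "Vector_Spaces.linear fscale fscale L \<Longrightarrow> L 0 = 0"
  "Vector_Spaces.linear fscale fscale L \<Longrightarrow> L (fscale c v) = fscale c (L v)"
  using Vector_Spaces.linear_def module_hom.zero module_hom.scale by blast+

lemmas fock_lin = linear_zero_scale[OF linear_shift_op] linear_zero_scale[OF linear_wedge]
  linear_zero_scale[OF linear_contract]

lemma wedge_ket: "wedge x (ket S) = (if x \<in> Rep_maya S then 0
     else fscale (raw_sign x (Rep_maya S)) (ket (Abs_maya (insert x (Rep_maya S)))))"
  by (simp add: wedge_def wedge_sign_raw)

lemma contract_ket: "contract x (ket S) = (if x \<in> Rep_maya S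
     then fscale (raw_sign x (Rep_maya S)) (ket (Abs_maya (Rep_maya S - {x}))) else 0)"
  by (simp add: contract_def wedge_sign_raw)

lemma shift_op_ket: "shift_op a (ket S) = fscale (eps a (Rep_maya S)) (ket (Abs_maya (shset a (Rep_maya S))))"
  by (simp add: shift_op_def)

lemma sh_mem_shset: "sh a x \<in> shset a X \<longleftrightarrow> x \<in> X"
  unfolding shset_def by (rule inj_image_mem_iff[OF inj_sh])

lemma shset_insert: "shset a (insert x X) = insert (sh a x) (shset a X)"
  by (simp add: shset_def)

lemma shset_remove: "shset a (X - {x}) = shset a X - {sh a x}"
  by (simp add: shset_def image_set_diff[OF inj_sh])

lemma raw_sign_remove: "raw_sign x (X - {x}) = raw_sign x X"
proof -
  have "{y \<in> X - {x}. pos y < pos x} = {y \<in> X. pos y < pos x}" by auto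
  then show ?thesis by (simp add: raw_sign_def)
qed

lemma sign_sq: "eps a X * eps a X = 1" "raw_sign x X * raw_sign x X = 1"
  by (simp_all add: eps_def raw_sign_def flip: power_mult_distrib)

abbreviation shift_sg :: "2 \<Rightarrow> mode \<Rightarrow> complex" where
  "shift_sg a x \<equiv> (if fst x = a then 1 else -1)"

lemma wedge_shift_op: "wedge (sh a x) (shift_op a v) = fscale (shift_sg a x) (shift_op a (wedge x v))"
proof -
  have "(\<lambda>v. wedge (sh a x) (shift_op a v)) = (\<lambda>v. fscale (shift_sg a x) (shift_op a (wedge x v)))"
  proof (rule linear_eq_on_ket[where sc = fscale])
    fix S
    let ?X = "Rep_maya S"
    show "wedge (sh a x) (shift_op a (ket S)) = fscale (shift_sg a x) (shift_op a (wedge x (ket S)))"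
    proof (cases "x \<in> ?X")
      case True
      then show ?thesis by (simp add: shift_op_ket wedge_ket fock_lin sh_mem_shset)
    next
      case False
      have "eps a ?X * raw_sign (sh a x) (shset a ?X) = shift_sg a x * (raw_sign x ?X * eps a (insert x ?X))"
        using sign_key[OF good_Rep False, of a] by (simp only: mult.commute)
      moreover have "wedge (sh a x) (shift_op a (ket S)) = fscale (eps a ?X * raw_sign (sh a x) (shset a ?X))
          (ket (Abs_maya (insert (sh a x) (shset a ?X))))"
        using False by (simp add: shift_op_ket wedge_ket fock_lin sh_mem_shset)
      moreover have "shift_op a (wedge x (ket S)) = fscale (raw_sign x ?X * eps a (insert x ?X))
          (ket (Abs_maya (insert (sh a x) (shset a ?X))))"
        using False by (simp add: shift_op_ket wedge_ket fock_lin shset_insert)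
      ultimately show ?thesis by (simp only: fock.scale_scale)
    qed
  qed (rule linear_comp[OF linear_wedge linear_shift_op]
     linear_fscale_comp[OF linear_comp[OF linear_shift_op linear_wedge]])+
  then show ?thesis by (rule fun_cong)
qed

lemma contract_shift_op: "contract (sh a x) (shift_op a v) = fscale (shift_sg a x) (shift_op a (contract x v))"
proof -
  have "(\<lambda>v. contract (sh a x) (shift_op a v)) = (\<lambda>v. fscale (shift_sg a x) (shift_op a (contract x v)))"
  proof (rule linear_eq_on_ket[where sc = fscale])
    fix S
    let ?X = "Rep_maya S" and ?Y = "Rep_maya S - {x}"
    show "contract (sh a x) (shift_op a (ket S)) = fscale (shift_sg a x) (shift_op a (contract x (ket S)))"
    proof (cases "x \<in> ?X")
      case False
      then show ?thesis by (simp add: shift_op_ket contract_ket fock_lin sh_mem_shset)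
    next
      case True
      let ?r = "raw_sign (sh a x) (shset a ?X)" and ?s = "raw_sign x ?X"
        and ?e = "eps a ?Y" and ?f = "eps a ?X"
      have "?r * ?e = shift_sg a x * (?f * ?s)"
        using sign_key[of ?Y x a] True
        by (simp add: insert_absorb raw_sign_remove shset_remove)
      then have "(?r * ?e) * (?f * ?e) = (shift_sg a x * (?f * ?s)) * (?f * ?e)" by (rule arg_cong)
      then have "?f * ?r * (?e * ?e) = shift_sg a x * (?s * ?e) * (?f * ?f)" by (simp only: mult_ac)
      then have "?f * ?r = shift_sg a x * (?s * ?e)" by (simp only: sign_sq mult_1_right)
      moreover have "contract (sh a x) (shift_op a (ket S)) = fscale (?f * ?r)
          (ket (Abs_maya (shset a ?X - {sh a x})))"
        using True by (simp add: shift_op_ket contract_ket fock_lin sh_mem_shset)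
      moreover have "shift_op a (contract x (ket S)) = fscale (?s * ?e)
          (ket (Abs_maya (shset a ?X - {sh a x})))"
        using True by (simp add: shift_op_ket contract_ket fock_lin shset_remove)
      ultimately show ?thesis by (simp only: fock.scale_scale)
    qed
  qed (rule linear_comp[OF linear_contract linear_shift_op]
     linear_fscale_comp[OF linear_comp[OF linear_shift_op linear_contract]])+
  then show ?thesis by (rule fun_cong)
qed

lemma psi_shift_op:
  "psi s b k (shift_op a v) = (if b = a then shift_op a (psi s b (k + charge_val s) v)
     else - shift_op a (psi s b k v))"
proof (cases s)
  case Cre
  then show ?thesis using wedge_shift_op[of a "(b, k + 1)" v] wedge_shift_op[of a "(b, k)" v]
    by (auto simp: sh_def)
next
  case Ann
  then show ?thesis using contract_shift_op[of a "(b, - k)" v] contract_shift_op[of a "(b, - k - 1)" v]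
    by (auto simp: sh_def)
qed

definition unshset :: "2 \<Rightarrow> mode set \<Rightarrow> mode set" where
  "unshset a X = sh a -` X"

lemma surj_sh: "surj (sh a)"
proof -
  have "y = sh a (if fst y = a then (a, snd y + 1) else y)" for y by (cases y) (auto simp: sh_def)
  then show ?thesis by (rule surjI[of "sh a" "\<lambda>y. if fst y = a then (a, snd y + 1) else y", OF sym])
qed

lemma unsh_sh [simp]: "unshset a (shset a X) = X" "shset a (unshset a X) = X"
  by (simp_all add: unshset_def shset_def inj_vimage_image_eq[OF inj_sh] surj_sh)

lemma good_unshset [simp]:
  assumes "good X"
  shows "good (unshset a X)"
proof (rule good_finite_diff[of vac_set])
  have "x \<in> vac_set - unshset a X \<longleftrightarrow> x \<in> sh a -` (shset a vac_set - X)"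
    "x \<in> unshset a X - vac_set \<longleftrightarrow> x \<in> sh a -` (X - shset a vac_set)" for x
    by (simp_all add: unshset_def sh_mem_shset)
  then have "vac_set - unshset a X = sh a -` (shset a vac_set - X)"
    "unshset a X - vac_set = sh a -` (X - shset a vac_set)"
    by blast+
  moreover have "finite (shset a vac_set - X)" "finite (X - shset a vac_set)"
    using assms unfolding shset_vac good_def
    by (auto intro: finite_subset[of _ "insert (a, -1) (vac_set - X)"] finite_subset[of _ "X - vac_set"])
  ultimately show "finite (vac_set - unshset a X)" "finite (unshset a X - vac_set)"
    by (simp_all add: finite_vimageI[OF _ inj_sh])
qed simp

lemma bij_shift_op: "bij (shift_op a)"
proof -
  define tinv where "tinv = lin_ext (\<lambda>S. fscale (eps a (unshset a (Rep_maya S)))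
     (ket (Abs_maya (unshset a (Rep_maya S)))))"
  have L: "Vector_Spaces.linear fscale fscale tinv" unfolding tinv_def by (rule linear_lin_ext)
  have I: "Vector_Spaces.linear fscale fscale (\<lambda>v. v)"
    by (simp add: Vector_Spaces.linear_iff fock.vector_space_axioms)
  have k: "tinv (ket S) = fscale (eps a (unshset a (Rep_maya S))) (ket (Abs_maya (unshset a (Rep_maya S))))" for S
    by (simp add: tinv_def)
  have "(\<lambda>v. tinv (shift_op a v)) = (\<lambda>v. v)"
    by (rule linear_eq_on_ket[OF linear_comp[OF L linear_shift_op] I])
      (simp add: shift_op_ket k linear_zero_scale[OF L] sign_sq Rep_maya_inverse)
  moreover have "(\<lambda>v. shift_op a (tinv v)) = (\<lambda>v. v)"
    by (rule linear_eq_on_ket[OF linear_comp[OF linear_shift_op L] I])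
      (simp add: shift_op_ket k fock_lin sign_sq Rep_maya_inverse)
  ultimately show ?thesis by (intro o_bij[of tinv]) (auto simp: fun_eq_iff)
qed

lemma shift_op_vac: "shift_op a vac = psi Cre a (-1) vac"
proof -
  have "eps_set a vac_set = {}" by (auto simp: eps_set_def vac_set_def)
  then have "eps a vac_set = 1" by (simp add: eps_def)
  moreover have "{y \<in> vac_set. pos y < pos (a, -1)} = {}"
    by (auto simp: vac_set_def pos_def split: if_splits)
  then have "raw_sign (a, -1) vac_set = 1" unfolding raw_sign_def by (simp only: card.empty power_0)
  moreover have "(a, -1) \<notin> vac_set" by (simp add: vac_set_def)
  ultimately show ?thesis by (simp add: vac_def shift_op_ket wedge_ket shset_vac)
qed

lemma raw_sign_insert:
  assumes "good X" "y \<notin> X"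
  shows "raw_sign x (insert y X) = (if pos y < pos x then - raw_sign x X else raw_sign x X)"
proof -
  have "{z \<in> insert y X. pos z < pos x} =
     (if pos y < pos x then insert y {z \<in> X. pos z < pos x} else {z \<in> X. pos z < pos x})" by auto
  then show ?thesis using finite_below[OF assms(1), of "pos x"] assms(2) by (simp add: raw_sign_def)
qed

lemma pos_inject: "pos x = pos y \<longleftrightarrow> x = y"
proof
  assume "pos x = pos y"
  then have *: "2 * snd x + (if fst x = 0 then 0 else 1) = 2 * snd y + (if fst y = 0 then 0 else 1)"
    by (simp only: pos_def)
  have "fst x = 0 \<longleftrightarrow> fst y = 0"
    using * by (cases "fst x = 0"; cases "fst y = 0"; simp; presburger)
  moreover from this have "snd x = snd y" using * by simp
  ultimately show "x = y" using two_cases[of "fst x"] two_cases[of "fst y"] by (auto simp: prod_eq_iff)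
qed simp

lemma wedge_wedge: "wedge x (wedge y v) = - wedge y (wedge x v)"
proof -
  have "(\<lambda>v. wedge x (wedge y v)) = (\<lambda>v. fscale (-1) (wedge y (wedge x v)))"
  proof (rule linear_eq_on_ket[where sc = fscale])
    fix S
    have "pos x < pos y \<or> pos y < pos x \<or> x = y" using pos_inject[of x y] by linarith
    then show "wedge x (wedge y (ket S)) = fscale (-1) (wedge y (wedge x (ket S)))"
      by (auto simp: wedge_ket fock_lin raw_sign_insert insert_commute mult.commute)
  qed (rule linear_comp[OF linear_wedge linear_wedge]
     linear_fscale_comp[OF linear_comp[OF linear_wedge linear_wedge]])+
  from fun_cong[OF this, of v] show ?thesis by simp
qed

lemma raw_sign_remove_other:
  assumes "good X" "y \<in> X"
  shows "raw_sign x (X - {y}) = (if pos y < pos x then - raw_sign x X else raw_sign x X)"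
  using raw_sign_insert[of "X - {y}" y x] assms by (simp add: insert_absorb split: if_splits)

lemma contract_contract: "contract x (contract y v) = - contract y (contract x v)"
proof -
  have "(\<lambda>v. contract x (contract y v)) = (\<lambda>v. fscale (-1) (contract y (contract x v)))"
  proof (rule linear_eq_on_ket[where sc = fscale])
    fix S
    let ?X = "Rep_maya S"
    have eq: "?X - {x} - {y} = ?X - {y} - {x}" by blast
    show "contract x (contract y (ket S)) = fscale (-1) (contract y (contract x (ket S)))"
    proof (cases "x \<noteq> y \<and> x \<in> ?X \<and> y \<in> ?X")
      case True
      then have ne: "x \<noteq> y" "y \<noteq> x" "x \<in> ?X" "y \<in> ?X" by auto
      have cmp: "pos y < pos x \<longleftrightarrow> \<not> pos x < pos y" using ne pos_inject[of x y] by linarith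
      have s: "raw_sign y ?X * raw_sign x (?X - {y}) = - (raw_sign x ?X * raw_sign y (?X - {x}))"
        using ne by (simp add: raw_sign_remove_other cmp)
      have "contract x (contract y (ket S)) = fscale (raw_sign y ?X * raw_sign x (?X - {y}))
          (ket (Abs_maya (?X - {y} - {x})))"
        using ne by (simp add: contract_ket fock_lin)
      moreover have "contract y (contract x (ket S)) = fscale (raw_sign x ?X * raw_sign y (?X - {x}))
          (ket (Abs_maya (?X - {x} - {y})))"
        using ne by (simp add: contract_ket fock_lin)
      ultimately show ?thesis unfolding eq s by simp
    next
      case False
      then have "contract x (contract y (ket S)) = 0" "contract y (contract x (ket S)) = 0"
        by (auto simp: contract_ket fock_lin)
      then show ?thesis by simp
    qed
  qed (rule linear_comp[OF linear_contract linear_contract]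
     linear_fscale_comp[OF linear_comp[OF linear_contract linear_contract]])+
  from fun_cong[OF this, of v] show ?thesis by simp
qed

lemma linear_add_comp:
  "Vector_Spaces.linear fscale fscale L \<Longrightarrow> Vector_Spaces.linear fscale fscale M
     \<Longrightarrow> Vector_Spaces.linear fscale fscale (\<lambda>v. L v + M v)"
  by (auto simp: Vector_Spaces.linear_iff fock.scale_right_distrib)

lemma wedge_contract: "wedge x (contract y v) + contract y (wedge x v) = (if x = y then v else 0)"
proof -
  have "(\<lambda>v. wedge x (contract y v) + contract y (wedge x v)) = fscale (if x = y then 1 else 0)"
  proof (rule linear_eq_on_ket[where sc = fscale])
    fix S
    let ?X = "Rep_maya S"
    show "wedge x (contract y (ket S)) + contract y (wedge x (ket S)) = fscale (if x = y then 1 else 0) (ket S)"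
    proof (cases "x = y")
      case True
      have "?X - {x} = ?X" if "x \<notin> ?X" using that by blast
      then show ?thesis using True raw_sign_insert[of ?X x x]
        by (cases "x \<in> ?X") (simp_all add: wedge_ket contract_ket fock_lin raw_sign_remove
          sign_sq insert_absorb Rep_maya_inverse)
    next
      case False
      have eq: "insert x ?X - {y} = insert x (?X - {y})" using False by blast
      have cmp: "pos y < pos x \<longleftrightarrow> \<not> pos x < pos y" using False pos_inject[of x y] by linarith
      show ?thesis
      proof (cases "x \<notin> ?X \<and> y \<in> ?X")
        case True
        then have s: "raw_sign y (insert x ?X) = (if pos x < pos y then - raw_sign y ?X else raw_sign y ?X)"
          "raw_sign x (?X - {y}) = (if pos x < pos y then raw_sign x ?X else - raw_sign x ?X)"
          by (simp_all add: raw_sign_insert raw_sign_remove_other cmp)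
        have "wedge x (contract y (ket S)) = fscale (raw_sign y ?X * raw_sign x (?X - {y}))
            (ket (Abs_maya (insert x (?X - {y}))))"
          using True by (simp add: wedge_ket contract_ket fock_lin)
        moreover have "contract y (wedge x (ket S)) = fscale (raw_sign x ?X * raw_sign y (insert x ?X))
            (ket (Abs_maya (insert x (?X - {y}))))"
          using True by (simp add: wedge_ket contract_ket fock_lin eq)
        ultimately show ?thesis using False by (simp add: s mult.commute flip: fock.scale_left_distrib)
      next
        case no: False
        then have "wedge x (contract y (ket S)) = 0" "contract y (wedge x (ket S)) = 0"
          using False by (auto simp: wedge_ket contract_ket fock_lin)
        then show ?thesis using False by simp
      qed
    qed
  qed (rule linear_add_comp linear_comp[OF linear_wedge linear_contract]
      linear_comp[OF linear_contract linear_wedge] fock.linear_scale_self)+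
  from fun_cong[OF this, of v] show ?thesis by simp
qed

theorem psi_anticommutator:
  "psi s a k (psi t b l v) + psi t b l (psi s a k v) =
     (if s \<noteq> t \<and> a = b \<and> k + l = -1 then v else 0)"
proof (cases s; cases t)
  assume "s = Cre" "t = Cre"
  then show ?thesis using wedge_wedge[of "(a, k)" "(b, l)" v] by simp
next
  assume "s = Ann" "t = Ann"
  then show ?thesis using contract_contract[of "(a, - k - 1)" "(b, - l - 1)" v] by simp
next
  assume "s = Cre" "t = Ann"
  then show ?thesis using wedge_contract[of "(a, k)" "(b, - l - 1)" v] by auto
next
  assume "s = Ann" "t = Cre"
  then show ?thesis using wedge_contract[of "(b, l)" "(a, - k - 1)" v]
    by (auto simp: add.commute)
qed

theorem psi_vac: "0 \<le> k \<Longrightarrow> psi s a k vac = 0"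
  by (cases s) (simp_all add: vac_def wedge_ket contract_ket, simp_all add: vac_set_def)

lemma is_translation_shift_op: "is_translation shift_op"
proof -
  have rel: "shift_op a (psi s b k v) = (if b = a then psi s b (k - charge_val s) (shift_op a v)
     else - psi s b k (shift_op a v))" for a s b k v
    using psi_shift_op[of s b "k - charge_val s" a v] psi_shift_op[of s b k a v] by (auto simp del: psi.simps)
  have anti: "shift_op a \<circ> shift_op b = - (shift_op b \<circ> shift_op a)" if ab: "a \<noteq> b" for a b
  proof -
    have neg: "psi s c k (- v) = - psi s c k v" for s c k v
      using linear_psi[of s c k] unfolding Vector_Spaces.linear_def by (blast intro: module_hom.neg)
    have tneg: "shift_op c (- v) = - shift_op c v" for c v
      using linear_shift_op[of c] unfolding Vector_Spaces.linear_def by (blast intro: module_hom.neg)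
    have "(\<lambda>v. shift_op a (shift_op b v)) = (\<lambda>v. fscale (-1) (shift_op b (shift_op a v)))"
    proof (rule words_linear_eq)
      have "shift_op c (shift_op d vac) = - wedge (d, -1) (wedge (c, -1) vac)" if "c \<noteq> d" for c d
      proof -
        have "shift_op c (shift_op d vac) = shift_op c (psi Cre d (-1) vac)" by (simp only: shift_op_vac)
        also have "\<dots> = - psi Cre d (-1) (psi Cre c (-1) vac)"
          using that unfolding rel shift_op_vac by simp
        finally show ?thesis by simp
      qed
      from this[OF ab] this[OF ab[symmetric]]
      show "shift_op a (shift_op b vac) = fscale (- 1) (shift_op b (shift_op a vac))"
        using wedge_wedge[of "(b, -1)" "(a, -1)" vac] by simp
    next
      fix s c k v assume IH: "shift_op a (shift_op b v) = fscale (- 1) (shift_op b (shift_op a v))"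
      consider "c = a" "c \<noteq> b" | "c = b" "c \<noteq> a" | "c \<noteq> a" "c \<noteq> b" using ab by blast
      then show "shift_op a (shift_op b (psi s c k v)) = fscale (- 1) (shift_op b (shift_op a (psi s c k v)))"
      proof cases
        case 1
        then show ?thesis using IH unfolding rel by (simp add: tneg neg rel del: psi.simps)
      next
        case 2
        then show ?thesis using IH unfolding rel by (simp add: tneg neg rel del: psi.simps)
      next
        case 3
        then show ?thesis using IH unfolding rel by (simp add: tneg neg rel del: psi.simps)
      qed
    qed (rule linear_comp[OF linear_shift_op linear_shift_op]
     linear_fscale_comp[OF linear_comp[OF linear_shift_op linear_shift_op]])+
    then show ?thesis by (auto simp: fun_eq_iff)
  qed
  show ?thesis unfolding is_translation_def
  proof (intro conjI allI impI)
    fix a b s n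
    show "(\<lambda>n. psi_field s a n \<circ> shift_op a) = w_times (charge_val s) (\<lambda>n. shift_op a \<circ> psi_field s a n)"
      by (simp add: fun_eq_iff w_times_def psi_field_def psi_shift_op algebra_simps del: psi.simps)
    assume "a \<noteq> b"
    then show "psi_field s a n \<circ> shift_op b = - (shift_op b \<circ> psi_field s a n)"
      by (simp add: fun_eq_iff psi_field_def psi_shift_op del: psi.simps)
  qed (simp_all only: linear_shift_op bij_shift_op shift_op_vac, rule anti)
qed

theorem ex1_translation: "\<exists>!Q. is_translation Q"
  using is_translation_shift_op translation_unique by blast

lemma is_translation_Q_op: "is_translation Q_op"
  unfolding Q_op_def by (rule theI'[OF ex1_translation])


subsection \<open>Finiteness of the sums in the definition of \<open>\<tau>\<close>\<close>

theorem finite_field_mult: "finite {p. psi_field Cre 1 p (psi_field Ann 0 (n - p) v) \<noteq> 0}"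
proof -
  interpret W: Vector_Spaces.linear fscale fscale "wedge x" for x by (rule linear_wedge)
  interpret K: Vector_Spaces.linear fscale fscale "contract x" for x by (rule linear_contract)
  have op: "psi_field Cre 1 p (psi_field Ann 0 (n - p) w) = wedge (1, - p - 1) (contract (0, n - p) w)" for p w
    by (simp add: psi_field_def)
  define P where "P S = {p. (0, n - p) \<in> Rep_maya S \<and> (1, - p - 1) \<notin> Rep_maya S}" for S
  have ket0: "wedge (1, - p - 1) (contract (0, n - p) (ket S)) = 0" if "p \<notin> P S" for p S
  proof (cases "(0, n - p) \<in> Rep_maya S")
    case True
    then have 1: "(1, - p - 1) \<in> Rep_maya S - {(0, n - p)}" using that by (simp add: P_def)
    have "finite (Rep_maya S - {(0, n - p)} - vac_set)" "finite (vac_set - (Rep_maya S - {(0, n - p)}))"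
      by (rule finite_subset[OF _ finite_Rep_maya(1)[of S]], blast)
        (rule finite_subset[of _ "insert (0, n - p) (vac_set - Rep_maya S)"], blast, simp add: finite_Rep_maya)
    then have "Rep_maya (Abs_maya (Rep_maya S - {(0, n - p)})) = Rep_maya S - {(0, n - p)}"
      by (rule Rep_Abs_maya)
    then show ?thesis using 1 True by (simp add: contract_def wedge_def W.scale[unfolded wedge_def])
  next
    case False
    then show ?thesis by (simp add: contract_def W.zero)
  qed
  have fin: "finite (P S)" for S
  proof (rule finite_subset)
    show "P S \<subseteq> {0..n} \<union> (\<lambda>x. n - snd x) ` (Rep_maya S - vac_set) \<union> (\<lambda>x. - snd x - 1) ` (vac_set - Rep_maya S)"
    proof
      fix p assume p: "p \<in> P S"
      consider "n < p" | "p < 0" | "p \<in> {0..n}" by fastforce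
      then show "p \<in> {0..n} \<union> (\<lambda>x. n - snd x) ` (Rep_maya S - vac_set) \<union> (\<lambda>x. - snd x - 1) ` (vac_set - Rep_maya S)"
      proof cases
        case 1
        then have "(0, n - p) \<in> Rep_maya S - vac_set" using p by (simp add: P_def vac_set_def)
        then have "(\<lambda>x. n - snd x) (0 :: 2, n - p) \<in> (\<lambda>x. n - snd x) ` (Rep_maya S - vac_set)" by (rule imageI)
        then show ?thesis by simp
      next
        case 2
        then have "(1, - p - 1) \<in> vac_set - Rep_maya S" using p by (simp add: P_def vac_set_def)
        then have "(\<lambda>x. - snd x - 1) (1 :: 2, - p - 1) \<in> (\<lambda>x. - snd x - 1) ` (vac_set - Rep_maya S)" by (rule imageI)
        then show ?thesis by simp
      qed simp
    qed
  qed (simp add: finite_Rep_maya)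
  show ?thesis
  proof (rule finite_subset)
    show "finite (\<Union>S\<in>Poly_Mapping.keys v. P S)" using fin by simp
    show "{p. psi_field Cre 1 p (psi_field Ann 0 (n - p) v) \<noteq> 0} \<subseteq> (\<Union>S\<in>Poly_Mapping.keys v. P S)"
    proof (rule subsetI, rule ccontr)
      fix p assume "p \<in> {p. psi_field Cre 1 p (psi_field Ann 0 (n - p) v) \<noteq> 0}"
        and "p \<notin> (\<Union>S\<in>Poly_Mapping.keys v. P S)"
      moreover have "wedge (1, - p - 1) (contract (0, n - p) v) =
         (\<Sum>S\<in>Poly_Mapping.keys v. fscale (Poly_Mapping.lookup v S) (wedge (1, - p - 1) (contract (0, n - p) (ket S))))"
        by (subst ket_expand) (simp add: W.sum K.sum W.scale K.scale)
      ultimately show False by (simp add: op ket0)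
    qed
  qed
qed

definition cdeg :: "cmono \<Rightarrow> nat" where
  "cdeg \<mu> = (\<Sum>i\<in>Poly_Mapping.keys \<mu>. Poly_Mapping.lookup \<mu> i)"

lemma cdeg_superset:
  "finite A \<Longrightarrow> Poly_Mapping.keys \<mu> \<subseteq> A \<Longrightarrow> cdeg \<mu> = (\<Sum>i\<in>A. Poly_Mapping.lookup \<mu> i)"
  unfolding cdeg_def by (intro sum.mono_neutral_left) (auto simp: in_keys_iff)

lemma cdeg_add: "cdeg (\<mu> + \<nu>) = cdeg \<mu> + cdeg \<nu>"
proof -
  let ?A = "Poly_Mapping.keys \<mu> \<union> Poly_Mapping.keys \<nu>"
  have "Poly_Mapping.keys (\<mu> + \<nu>) \<subseteq> ?A" by (rule Poly_Mapping.keys_add)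
  then show ?thesis
    by (subst (1 2 3) cdeg_superset[of ?A]) (auto simp: lookup_add sum.distrib)
qed

lemma cdeg_single [simp]: "cdeg (Poly_Mapping.single i n) = n"
  by (simp add: cdeg_def)

lemma lookup_C_alpha:
  "Poly_Mapping.lookup (C_alpha \<alpha> p) \<nu> =
     (if \<nu> = Poly_Mapping.single (\<alpha> - p - 1) 1 then (-1) powi \<alpha> else 0)"
  by (auto simp: C_alpha_def w_times_def C_series_def cvar_def cconst_def mult_single lookup_single when_def)

lemma finite_antidiagonal: "finite {(\<nu>, \<rho>). \<nu> + \<rho> = (\<mu> :: cmono)}"
proof -
  let ?K = "Poly_Mapping.keys \<mu>"
  let ?F = "{f. \<forall>i. (i \<in> ?K \<longrightarrow> f i \<in> {..cdeg \<mu>}) \<and> (i \<notin> ?K \<longrightarrow> f i = 0)}"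
  let ?N = "{\<nu>. \<exists>\<rho>. \<nu> + \<rho> = \<mu>}"
  have "Poly_Mapping.lookup ` ?N \<subseteq> ?F"
  proof safe
    fix \<nu> \<rho> i assume "\<mu> = \<nu> + \<rho>"
    have "Poly_Mapping.lookup (\<nu> + \<rho>) i \<le> cdeg (\<nu> + \<rho>)" if "i \<in> Poly_Mapping.keys (\<nu> + \<rho>)"
      using that unfolding cdeg_def by (intro member_le_sum) auto
    then show "i \<in> Poly_Mapping.keys (\<nu> + \<rho>) \<Longrightarrow> Poly_Mapping.lookup \<nu> i \<le> cdeg (\<nu> + \<rho>)"
      by (simp add: lookup_add)
    show "i \<notin> Poly_Mapping.keys (\<nu> + \<rho>) \<Longrightarrow> Poly_Mapping.lookup \<nu> i = 0"
      by (simp add: in_keys_iff lookup_add)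
  qed
  moreover have "finite ?F" by (rule finite_set_of_finite_funs) simp_all
  ultimately have "finite (Poly_Mapping.lookup ` ?N)" by (rule finite_subset)
  then have "finite ?N" by (rule finite_imageD) (auto simp: inj_on_def intro: poly_mapping_eqI)
  moreover have "{(\<nu>, \<rho>). \<nu> + \<rho> = \<mu>} \<subseteq> (\<lambda>\<nu>. (\<nu>, \<mu> - \<nu>)) ` ?N" by auto
  ultimately show ?thesis by (meson finite_imageI finite_subset)
qed

lemma cmult_C_alpha_nonzero:
  assumes "cmult (C_alpha \<alpha> p) u \<mu> \<noteq> 0"
  shows "\<exists>\<rho>. Poly_Mapping.single (\<alpha> - p - 1) 1 + \<rho> = \<mu> \<and> u \<rho> \<noteq> 0"
proof (rule ccontr)
  assume "\<not> ?thesis"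
  then have "cmult (C_alpha \<alpha> p) u \<mu> = 0"
    unfolding cmult_def by (intro sum.neutral) (auto simp: lookup_C_alpha)
  with assms show False by simp
qed

theorem finite_current: "finite {p. cmult (C_alpha \<alpha> p) (A (n - p) \<circ> u) \<mu> \<noteq> 0}"
proof (rule finite_subset)
  show "{p. cmult (C_alpha \<alpha> p) (A (n - p) \<circ> u) \<mu> \<noteq> 0} \<subseteq> (\<lambda>j. \<alpha> - j - 1) ` Poly_Mapping.keys \<mu>"
  proof
    fix p assume "p \<in> {p. cmult (C_alpha \<alpha> p) (A (n - p) \<circ> u) \<mu> \<noteq> 0}"
    then obtain \<rho> where "Poly_Mapping.single (\<alpha> - p - 1) 1 + \<rho> = \<mu>"
      using cmult_C_alpha_nonzero by blast
    then have "\<alpha> - p - 1 \<in> Poly_Mapping.keys \<mu>" by (auto simp: in_keys_iff lookup_add)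
    then have "\<alpha> - (\<alpha> - p - 1) - 1 \<in> (\<lambda>j. \<alpha> - j - 1) ` Poly_Mapping.keys \<mu>" by (rule imageI)
    then show "p \<in> (\<lambda>j. \<alpha> - j - 1) ` Poly_Mapping.keys \<mu>" by simp
  qed
qed simp

lemma current_pow_zero: "cdeg \<mu> < n \<Longrightarrow> (current \<alpha> ^^ n) u \<mu> = 0"
proof (induction n arbitrary: \<mu>)
  case (Suc n)
  interpret W: Vector_Spaces.linear fscale fscale "wedge x" for x by (rule linear_wedge)
  interpret K: Vector_Spaces.linear fscale fscale "contract x" for x by (rule linear_contract)
  let ?A = "field_mult (psi_field Cre 1) (psi_field Ann 0)"
  have A0: "?A m 0 = 0" for m by (simp add: field_mult_def psi_field_def W.zero K.zero)
  have "cmult (C_alpha \<alpha> p) (?A (- 1 - p) \<circ> (current \<alpha> ^^ n) u) \<mu> = 0" for p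
  proof (rule ccontr)
    assume "\<not> ?thesis"
    then obtain \<rho> where r: "Poly_Mapping.single (\<alpha> - p - 1) 1 + \<rho> = \<mu>"
      "?A (- 1 - p) ((current \<alpha> ^^ n) u \<rho>) \<noteq> 0"
      using cmult_C_alpha_nonzero[of \<alpha> p "?A (- 1 - p) \<circ> (current \<alpha> ^^ n) u" \<mu>]
      unfolding o_apply by blast
    have "cdeg \<mu> = 1 + cdeg \<rho>" using r(1) cdeg_add cdeg_single by metis
    then have "(current \<alpha> ^^ n) u \<rho> = 0" using Suc.prems by (intro Suc.IH) simp
    then show False using r(2) A0 by (metis)
  qed
  then have "Sum_any (\<lambda>p. cmult (C_alpha \<alpha> p) (?A (- 1 - p) \<circ> (current \<alpha> ^^ n) u) \<mu>) = 0"
    by (simp only: Sum_any.neutral)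
  then have "current \<alpha> ((current \<alpha> ^^ n) u) \<mu> = 0"
    by (simp only: current_def Res_def cfield_mult_def)
  then show ?case by simp
qed simp

theorem finite_exp: "finite {n. fscale (1 / fact n) ((current \<alpha> ^^ n) u \<mu>) \<noteq> 0}"
proof (rule finite_subset)
  show "{n. fscale (1 / fact n) ((current \<alpha> ^^ n) u \<mu>) \<noteq> 0} \<subseteq> {..cdeg \<mu>}"
  proof (rule subsetI, rule ccontr)
    fix n assume n: "n \<in> {n. fscale (1 / fact n) ((current \<alpha> ^^ n) u \<mu>) \<noteq> 0}" and "n \<notin> {..cdeg \<mu>}"
    then have "(current \<alpha> ^^ n) u \<mu> = 0" by (intro current_pow_zero) simp
    with n show False by simp
  qed
qed simp

end

theory Submission
  imports Defs
begin

text \<open>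
  Both formulas for the \<open>\<tau>\<close>-function are the same Hankel determinant, reached from two sides.

  The fermionic side rests on adjoints. The current moves a particle from a mode \<open>e\<^sub>0 z\<^sup>m\<close> to a mode
  \<open>e\<^sub>1 z\<^bsup>-1 - q\<^esup>\<close> with weight \<open>(-1)\<^sup>\<alpha> c\<^bsub>\<alpha> + q + m\<^esub>\<close>, and \<open>T\<^sup>k v\<^sub>0\<close> is, up to an explicit sign, the vacuum with
  the modes \<open>m = 0, \<dots>, k - 1\<close> of component 0 emptied and \<open>q = 0, \<dots>, k - 1\<close> of component 1 filled
  (\<open>T_power_vac\<close>). Pairing a power of the current applied to the vacuum with such a wedge and letting
  one factor of the current act on the other side removes one filled mode and one emptied mode in
  all possible ways. Carrying the fermions to their partners produces the sign \<open>(-1)\<^bsup>r + s\<^esup>\<close> of a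
  cofactor, so the recursion is the Laplace expansion of the matrix of weights, summed over all rows
  (\<open>two_contractions_excitation\<close>, \<open>det_full_expansion\<close>). Hence the \<open>N\<close>-th power of the current,
  applied to the vacuum and paired with \<open>T\<^sup>k v\<^sub>0\<close>, gives \<open>N!\<close> times the determinant if \<open>N = k\<close>, and zero
  otherwise (\<open>coord_form_current_power\<close>); the exponential removes the factorial. For \<open>k < 0\<close> the wedge \<open>T\<^sup>k v\<^sub>0\<close>
  contains \<open>e\<^sub>0 z\<^sup>-\<^sup>1\<close>, which the current cannot create, and the pairing vanishes
  (\<open>coord_form_T_power_neg\<close>).

  On the residue side the product of the \<open>(w\<^sub>i - w\<^sub>j)\<^sup>2\<close> is the square of the Vandermonde determinant.
  Expanding both factors over permutations and taking residues termwise gives \<open>k!\<close> copies of the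
  Hankel determinant (\<open>Res_sq_vandermonde\<close>).
\<close>

section \<open>Products of fermions\<close>

fun fermion_prod :: "charge \<Rightarrow> 2 \<Rightarrow> nat \<Rightarrow> (nat \<Rightarrow> int) \<Rightarrow> fock \<Rightarrow> fock" where
  "fermion_prod s a 0 f v = v"
| "fermion_prod s a (Suc n) f v = psi_field s a (f 0) (fermion_prod s a n (\<lambda>i. f (Suc i)) v)"

primrec opp :: "charge \<Rightarrow> charge" where
  "opp Cre = Ann"
| "opp Ann = Cre"

lemma opp_neq [simp]: "opp s \<noteq> s" "s \<noteq> opp s"
  by (cases s; simp)+

lemma psi_zero [simp]: "psi s a k 0 = 0"
  and psi_add: "psi s a k (v + w) = psi s a k v + psi s a k w"
  and psi_neg: "psi s a k (- v) = - psi s a k v"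
  and psi_diff: "psi s a k (v - w) = psi s a k v - psi s a k w"
  and psi_scale: "psi s a k (fscale c v) = fscale c (psi s a k v)"
  and psi_sum: "psi s a k (sum F A) = (\<Sum>x\<in>A. psi s a k (F x))"
proof -
  interpret L: Vector_Spaces.linear fscale fscale "psi s a k" by (rule linear_psi)
  show "psi s a k 0 = 0" "psi s a k (v + w) = psi s a k v + psi s a k w"
    "psi s a k (- v) = - psi s a k v" "psi s a k (v - w) = psi s a k v - psi s a k w"
    "psi s a k (fscale c v) = fscale c (psi s a k v)"
    "psi s a k (sum F A) = (\<Sum>x\<in>A. psi s a k (F x))"
    by (rule L.zero L.add L.neg L.diff L.scale L.sum)+
qed

lemma psi_pass: "psi s a k (psi t b l v) =
    (if s \<noteq> t \<and> a = b \<and> k + l = -1 then v else 0) - psi t b l (psi s a k v)"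
  using psi_anticommutator[of s a k t b l v] by (simp add: eq_diff_eq)

lemma psi_fermion_prod_other:
  assumes "s = t \<or> a \<noteq> b"
  shows "psi s a k (fermion_prod t b n f v) = fscale ((-1) ^ n) (fermion_prod t b n f (psi s a k v))"
proof (induction n arbitrary: f)
  case (Suc n)
  show ?case using assms Suc
    by (auto simp: psi_field_def psi_pass[of s a k] psi_scale)
qed simp

lemma fermion_prod_zero [simp]: "fermion_prod s a n f 0 = 0"
  by (induction n arbitrary: f) (simp_all add: psi_field_def)

lemma fermion_prod_scale: "fermion_prod s a n f (fscale c v) = fscale c (fermion_prod s a n f v)"
  by (induction n arbitrary: f) (simp_all add: psi_field_def psi_scale)

lemma fermion_prod_sum: "fermion_prod s a n f (sum F A) = (\<Sum>x\<in>A. fermion_prod s a n f (F x))"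
  by (induction n arbitrary: f) (simp_all add: psi_field_def psi_sum)

lemma insert_index_Suc: "insert_index (Suc r) (Suc i) = Suc (insert_index r i)"
  by (simp add: insert_index_def)

text \<open>
  This is the Leibniz rule of an odd derivation: the conjugate fermion is carried through the
  product from the left. Passing a factor changes the sign, and a factor of matching mode also
  contributes the term in which it is deleted. Deleting the factor \<open>r\<close> is precomposition with \<open>insert_index r\<close>, the map that skips
  \<open>r\<close>; the same map describes the minors in the Laplace expansion, which is why the two expansions
  match below without any rearrangement.
\<close>

lemma psi_opp_fermion_prod:
  "psi (opp s) a q (fermion_prod s a (Suc n) f v) =
     (\<Sum>r<Suc n. fscale (if f r = q then (-1) ^ r else 0) (fermion_prod s a n (\<lambda>i. f (insert_index r i)) v))
     + fscale ((-1) ^ Suc n) (fermion_prod s a (Suc n) f (psi (opp s) a q v))"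
proof (induction n arbitrary: f)
  case 0
  show ?case
    by (auto simp: psi_field_def psi_pass[of "opp s" a q])
next
  case (Suc n)
  let ?h = "\<lambda>i. f (Suc i)"
  have "psi (opp s) a q (fermion_prod s a (Suc (Suc n)) f v) =
      fscale (if f 0 = q then 1 else 0) (fermion_prod s a (Suc n) ?h v)
      - psi s a (- f 0 - 1) (psi (opp s) a q (fermion_prod s a (Suc n) ?h v))"
    by (subst fermion_prod.simps(2), subst psi_field_def, subst psi_pass) auto
  also have "psi s a (- f 0 - 1) (psi (opp s) a q (fermion_prod s a (Suc n) ?h v)) =
      (\<Sum>r<Suc n. fscale (if ?h r = q then (-1) ^ r else 0)
         (psi s a (- f 0 - 1) (fermion_prod s a n (\<lambda>i. ?h (insert_index r i)) v)))
      + fscale ((-1) ^ Suc n) (fermion_prod s a (Suc (Suc n)) f (psi (opp s) a q v))"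
    unfolding Suc.IH by (simp add: psi_add psi_sum psi_scale psi_field_def psi_neg psi_diff del: sum.lessThan_Suc)
  also have "(\<Sum>r<Suc n. fscale (if ?h r = q then (-1) ^ r else 0)
         (psi s a (- f 0 - 1) (fermion_prod s a n (\<lambda>i. ?h (insert_index r i)) v))) =
      - (\<Sum>r<Suc n. fscale (if f (Suc r) = q then (-1) ^ Suc r else 0)
         (fermion_prod s a (Suc n) (\<lambda>i. f (insert_index (Suc r) i)) v))"
    unfolding sum_negf[symmetric]
    by (intro sum.cong refl) (simp add: insert_index_Suc psi_field_def del: insert_index(2))
  finally show ?case
    unfolding sum.lessThan_Suc_shift[of _ "Suc n"]
    by (simp add: algebra_simps del: fermion_prod.simps sum.lessThan_Suc)
qed

section \<open>The current on vectors reached from the vacuum\<close>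

text \<open>
  The vacuum lies in this space and the current preserves it. On the whole Fock space the modes of
  \<open>\<psi>\<^sub>1\<^sup>+(w) \<psi>\<^sub>0\<^sup>-(w)\<close> are sums whose range depends on the vector; on this space they are sums over
  \<open>{0..n}\<close>, because in every other summand one of the two anticommuting factors annihilates the vector.
\<close>

definition half_vacuum :: "fock set" where
  "half_vacuum = {v. \<forall>k\<ge>0. psi Cre 1 k v = 0 \<and> psi Ann 0 k v = 0}"

lemma subspace_half_vacuum: "fock.subspace half_vacuum"
  by (auto simp: fock.subspace_def half_vacuum_def psi_add psi_scale simp del: psi.simps)

lemma vac_half_vacuum: "vac \<in> half_vacuum"
  by (simp add: half_vacuum_def psi_vac del: psi.simps)

lemma Sum_any_in_subspace: "fock.subspace V \<Longrightarrow> (\<And>x. F x \<in> V) \<Longrightarrow> Sum_any F \<in> V"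
  unfolding Sum_any.expand_set by (rule fock.subspace_sum)

lemma field_mult_half_vacuum:
  assumes "v \<in> half_vacuum"
  shows "field_mult (psi_field Cre 1) (psi_field Ann 0) n v \<in> half_vacuum"
  unfolding field_mult_def
proof (rule Sum_any_in_subspace[OF subspace_half_vacuum])
  fix p
  have pass: "psi s b k (psi_field Cre 1 p (psi_field Ann 0 (n - p) v)) =
      psi_field Cre 1 p (psi_field Ann 0 (n - p) (psi s b k v))"
    if "(s, b) = (Cre, 1) \<or> (s, b) = (Ann, 0)" for s b k
    using that by (auto simp: psi_field_def psi_pass[of s b k] psi_neg simp del: psi.simps)
  show "psi_field Cre 1 p (psi_field Ann 0 (n - p) v) \<in> half_vacuum"
    using assms by (auto simp: half_vacuum_def pass simp del: psi.simps) (simp_all add: psi_field_def del: psi.simps)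
qed

text \<open>
  Since \<open>C\<^sup>(\<^sup>\<alpha>\<^sup>)\<close> has monomial coefficients, multiplying by one of them shifts the exponents: the
  value at \<open>\<mu>\<close> is read off from \<open>\<mu>\<close> divided by one variable. Hence the current at \<open>\<mu>\<close> becomes a sum
  over the variables that occur in \<open>\<mu>\<close>.
\<close>

lemma cmult_C_alpha:
  "cmult (C_alpha \<alpha> p) w \<mu> =
    (if \<alpha> - p - 1 \<in> Poly_Mapping.keys \<mu>
     then fscale ((-1) powi \<alpha>) (w (\<mu> - Poly_Mapping.single (\<alpha> - p - 1) 1)) else 0)"
proof -
  let ?e = "Poly_Mapping.single (\<alpha> - p - 1) (1::nat)"
  have "cmult (C_alpha \<alpha> p) w \<mu> =
      (\<Sum>x | fst x + snd x = \<mu>. if fst x = ?e then fscale ((-1) powi \<alpha>) (w (\<mu> - ?e)) else 0)"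
    unfolding cmult_def by (intro sum.cong) (auto simp: lookup_C_alpha)
  also have "\<dots> = (\<Sum>x\<in>{x. fst x + snd x = \<mu> \<and> fst x = ?e}. fscale ((-1) powi \<alpha>) (w (\<mu> - ?e)))"
    using finite_antidiagonal[of \<mu>] unfolding case_prod_beta'
    by (intro sum.mono_neutral_cong_right) auto
  also have "{x. fst x + snd x = \<mu> \<and> fst x = ?e} =
      (if \<alpha> - p - 1 \<in> Poly_Mapping.keys \<mu> then {(?e, \<mu> - ?e)} else {})"
  proof -
    have "?e + (\<mu> - ?e) = \<mu>" if "\<alpha> - p - 1 \<in> Poly_Mapping.keys \<mu>"
      using that
      by (intro poly_mapping_eqI) (auto simp: lookup_add lookup_minus lookup_single when_def in_keys_iff)
    moreover have "\<alpha> - p - 1 \<in> Poly_Mapping.keys (?e + \<nu>)" for \<nu>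
      by (simp add: in_keys_iff lookup_add)
    ultimately show ?thesis by auto
  qed
  finally show ?thesis by auto
qed

lemma current_eq:
  "current \<alpha> u \<mu> = (\<Sum>i\<in>Poly_Mapping.keys \<mu>. fscale ((-1) powi \<alpha>)
     (field_mult (psi_field Cre 1) (psi_field Ann 0) (i - \<alpha>) (u (\<mu> - Poly_Mapping.single i 1))))"
proof -
  let ?A = "field_mult (psi_field Cre 1) (psi_field Ann 0)"
  have "current \<alpha> u \<mu> = Sum_any (\<lambda>p. cmult (C_alpha \<alpha> p) (?A (- 1 - p) \<circ> u) \<mu>)"
    by (simp only: current_def Res_def cfield_mult_def)
  also have "\<dots> = (\<Sum>p\<in>(\<lambda>i. \<alpha> - i - 1) ` Poly_Mapping.keys \<mu>.
      cmult (C_alpha \<alpha> p) (?A (- 1 - p) \<circ> u) \<mu>)"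
  proof (rule Sum_any.expand_superset)
    show "{p. cmult (C_alpha \<alpha> p) (?A (- 1 - p) \<circ> u) \<mu> \<noteq> 0} \<subseteq> (\<lambda>i. \<alpha> - i - 1) ` Poly_Mapping.keys \<mu>"
      by (auto simp: cmult_C_alpha image_iff intro!: bexI[of _ "\<alpha> - _ - 1"] split: if_splits)
  qed simp
  also have "\<dots> = (\<Sum>i\<in>Poly_Mapping.keys \<mu>. fscale ((-1) powi \<alpha>) (?A (i - \<alpha>) (u (\<mu> - Poly_Mapping.single i 1))))"
    by (subst sum.reindex) (auto simp: inj_on_def cmult_C_alpha intro!: sum.cong)
  finally show ?thesis .
qed

lemma current_power_half_vacuum: "(current \<alpha> ^^ N) (fock_const vac) \<mu> \<in> half_vacuum"
proof (induction N arbitrary: \<mu>)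
  case 0
  show ?case using vac_half_vacuum fock.subspace_0[OF subspace_half_vacuum]
    by (simp add: fock_const_def)
next
  case (Suc N)
  show ?case
    unfolding funpow.simps o_apply current_eq[of \<alpha> "(current \<alpha> ^^ N) (fock_const vac)"]
    by (intro fock.subspace_sum fock.subspace_scale subspace_half_vacuum field_mult_half_vacuum Suc)
qed

section \<open>Adjoints\<close>

lemma coord_form_sym: "coord_form v w = coord_form w v"
  by (subst (1 2) coord_form_superset[of "Poly_Mapping.keys v \<union> Poly_Mapping.keys w"])
    (auto simp: mult.commute)

text \<open>
  Both sides delete or insert the same factor, and the sign depends only on the factors standing
  before it, which are the same in both wedges.
\<close>

lemma wedge_adjoint: "coord_form u (wedge x v) = coord_form (contract x u) v"
proof -
  have kets: "coord_form (ket S) (wedge x (ket S')) = coord_form (contract x (ket S)) (ket S')" for S S'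
  proof -
    have scale: "coord_form a (fscale c b) = c * coord_form a b"
      "coord_form (fscale c b) a = c * coord_form b a" for a b c
      using linear_coord_form[unfolded Vector_Spaces.linear_iff] by auto
    have zero: "coord_form a 0 = 0" "coord_form 0 a = 0" for a by (simp_all add: coord_form_def)
    have eq: "Abs_maya X = S \<longleftrightarrow> X = Rep_maya S" if "good X" for X S
      using that by (metis good_Rep_Abs Rep_maya_inverse)
    show ?thesis
      by (auto simp: wedge_ket contract_ket scale zero coord_form_ket eq
          eq_commute[of _ "Abs_maya _"] raw_sign_remove insert_absorb)
        (metis Diff_insert_absorb raw_sign_remove)+
  qed
  have L: "Vector_Spaces.linear fscale (*) (\<lambda>v. coord_form u (wedge x v))" for u
    using linear_coord_form(1)[of u] linear_wedge[of x] by (auto simp: Vector_Spaces.linear_iff)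
  have R: "Vector_Spaces.linear fscale (*) (\<lambda>u. coord_form (contract x u) v)" for v
    using linear_coord_form(2)[of v] linear_contract[of x] by (auto simp: Vector_Spaces.linear_iff)
  have "(\<lambda>v. coord_form (ket S) (wedge x v)) = coord_form (contract x (ket S))" for S
    by (rule linear_eq_on_ket[OF L linear_coord_form(1) kets])
  then have "(\<lambda>u. coord_form u (wedge x v)) = (\<lambda>u. coord_form (contract x u) v)"
    by (intro linear_eq_on_ket[OF linear_coord_form(2) R]) (simp add: fun_eq_iff)
  then show ?thesis by (rule fun_cong)
qed

lemma psi_adjoint: "coord_form u (psi s a k v) = coord_form (psi (opp s) a (- k - 1) u) v"
proof (cases s)
  case Cre
  then show ?thesis by (simp add: wedge_adjoint)
next
  case Ann
  have "coord_form u (contract x v) = coord_form (wedge x u) v" for x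
    using wedge_adjoint[of v x u] by (simp add: coord_form_sym)
  then show ?thesis using Ann by simp
qed

lemma coord_form_linear:
  "coord_form v (fscale c w) = c * coord_form v w" "coord_form (fscale c v) w = c * coord_form v w"
  "coord_form v 0 = 0" "coord_form 0 w = 0"
  "coord_form v (sum F A) = (\<Sum>x\<in>A. coord_form v (F x))"
  "coord_form (sum F A) w = (\<Sum>x\<in>A. coord_form (F x) w)"
proof -
  interpret L: Vector_Spaces.linear fscale "(*)" "coord_form v" by (rule linear_coord_form)
  interpret R: Vector_Spaces.linear fscale "(*)" "\<lambda>v. coord_form v w" by (rule linear_coord_form)
  show "coord_form v (fscale c w) = c * coord_form v w" "coord_form (fscale c v) w = c * coord_form v w"
  "coord_form v 0 = 0" "coord_form 0 w = 0"
  "coord_form v (sum F A) = (\<Sum>x\<in>A. coord_form v (F x))"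
  "coord_form (sum F A) w = (\<Sum>x\<in>A. coord_form (F x) w)"
    by (rule L.scale R.scale L.zero R.zero L.sum R.sum)+
qed

lemma coord_form_field_mult:
  assumes "v \<in> half_vacuum"
  shows "coord_form w (field_mult (psi_field Cre 1) (psi_field Ann 0) n v) =
    (\<Sum>q\<in>{0..n}. coord_form (psi Cre 0 (n - q) (psi Ann 1 q w)) v)"
proof -
  have "field_mult (psi_field Cre 1) (psi_field Ann 0) n v =
      (\<Sum>q\<in>{0..n}. psi_field Cre 1 q (psi_field Ann 0 (n - q) v))"
    unfolding field_mult_def
  proof (rule Sum_any.expand_superset)
    show "{q. psi_field Cre 1 q (psi_field Ann 0 (n - q) v) \<noteq> 0} \<subseteq> {0..n}"
    proof (rule subsetI, rule ccontr)
      fix q assume q: "q \<in> {q. psi_field Cre 1 q (psi_field Ann 0 (n - q) v) \<noteq> 0}" "q \<notin> {0..n}"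
      then consider "n < q" | "q < 0" by fastforce
      then have "psi_field Cre 1 q (psi_field Ann 0 (n - q) v) = 0"
      proof cases
        case 1
        then have "psi Ann 0 (q - n - 1) v = 0" using assms by (simp add: half_vacuum_def del: psi.simps)
        then show ?thesis by (simp add: psi_field_def del: psi.simps)
      next
        case 2
        then have "psi Cre 1 (- q - 1) v = 0" using assms by (simp add: half_vacuum_def del: psi.simps)
        then show ?thesis
          by (simp add: psi_field_def psi_pass[of Cre 1 "- q - 1"] del: psi.simps)
      qed
      then show False using q by simp
    qed
  qed simp
  then show ?thesis
    by (simp add: coord_form_linear psi_field_def psi_adjoint[of _ Cre 1] psi_adjoint[of _ Ann 0]
        del: psi.simps)
qed

section \<open>Matrix elements of powers of the current\<close>

text \<open>
  For nonnegative injective \<open>f\<close> and \<open>g\<close> this is, up to sign, the wedge obtained from the vacuum by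
  moving particles from the modes \<open>e\<^sub>0 z\<^bsup>g j\<^esup>\<close> to the modes \<open>e\<^sub>1 z\<^bsup>-1 - f i\<^esup>\<close>, where \<open>i, j < n\<close>.
\<close>

definition excitation :: "nat \<Rightarrow> (nat \<Rightarrow> int) \<Rightarrow> (nat \<Rightarrow> int) \<Rightarrow> fock" where
  "excitation n f g = fermion_prod Cre 1 n f (fermion_prod Ann 0 n g vac)"

text \<open>
  The Leibniz rule applied once in each component. The factor \<open>(-1)\<^sup>n\<close> comes from carrying the
  second fermion past the \<open>n\<close> remaining fermions of component 1; the rest of the sign is that of
  a cofactor.
\<close>

lemma two_contractions_excitation:
  assumes "0 \<le> q" "0 \<le> m"
  shows "psi Cre 0 m (psi Ann 1 q (excitation (Suc n) f g)) =
    (\<Sum>r<Suc n. \<Sum>s<Suc n. fscale (if f r = q \<and> g s = m then (-1) ^ (n + r + s) else 0)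
       (excitation n (\<lambda>i. f (insert_index r i)) (\<lambda>i. g (insert_index s i))))"
proof -
  have 1: "psi Ann 1 q (excitation (Suc n) f g) =
      (\<Sum>r<Suc n. fscale (if f r = q then (-1) ^ r else 0)
        (fermion_prod Cre 1 n (\<lambda>i. f (insert_index r i)) (fermion_prod Ann 0 (Suc n) g vac)))"
    using psi_opp_fermion_prod[of Cre 1 q n f "fermion_prod Ann 0 (Suc n) g vac"] assms
    by (simp add: excitation_def psi_fermion_prod_other psi_vac del: fermion_prod.simps psi.simps sum.lessThan_Suc)
  have 2: "psi Cre 0 m (fermion_prod Ann 0 (Suc n) g vac) =
      (\<Sum>s<Suc n. fscale (if g s = m then (-1) ^ s else 0)
        (fermion_prod Ann 0 n (\<lambda>i. g (insert_index s i)) vac))"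
    using psi_opp_fermion_prod[of Ann 0 m n g vac] assms
    by (simp add: psi_vac del: fermion_prod.simps psi.simps sum.lessThan_Suc)
  show ?thesis
    unfolding 1 psi_sum psi_scale
    by (simp add: psi_fermion_prod_other 2 fermion_prod_sum fermion_prod_scale fock.scale_sum_right
        excitation_def power_add del: fermion_prod.simps psi.simps sum.lessThan_Suc)
      (intro sum.cong refl, simp add: power_add mult_ac)
qed

lemma lookup_cconst_mult: "Poly_Mapping.lookup (cconst c * p) \<mu> = c * Poly_Mapping.lookup p \<mu>"
  by (simp add: cconst_def mult_map_scale_conv_mult[symmetric] Poly_Mapping.map.rep_eq when_def)

lemma lookup_cvar_mult:
  "Poly_Mapping.lookup (cvar j * p) \<mu> =
    (if j \<in> Poly_Mapping.keys \<mu> then Poly_Mapping.lookup p (\<mu> - Poly_Mapping.single j 1) else 0)"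
proof -
  let ?e = "Poly_Mapping.single j (1::nat)"
  have "Poly_Mapping.lookup (cvar j * p) \<mu> = Sum_any (\<lambda>\<rho>. Poly_Mapping.lookup p \<rho> when \<mu> = ?e + \<rho>)"
    by (simp add: cvar_def lookup_mult lookup_single when_mult)
  moreover have "\<mu> = ?e + \<rho> \<longleftrightarrow> j \<in> Poly_Mapping.keys \<mu> \<and> \<rho> = \<mu> - ?e" for \<rho>
  proof -
    have "?e + (\<mu> - ?e) = \<mu>" if "j \<in> Poly_Mapping.keys \<mu>"
      using that
      by (intro poly_mapping_eqI) (auto simp: lookup_add lookup_minus lookup_single when_def in_keys_iff)
    moreover have "j \<in> Poly_Mapping.keys (?e + \<rho>)" by (simp add: in_keys_iff lookup_add)
    ultimately show ?thesis by auto
  qed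
  ultimately show ?thesis by simp
qed

text \<open>
  For \<open>f = g = int\<close> this is the Hankel matrix of the theorem with the factor \<open>(-1)\<^sup>\<alpha>\<close> of
  \<open>C\<^sup>(\<^sup>\<alpha>\<^sup>)\<close> in each entry. Other \<open>f\<close> and \<open>g\<close> give its submatrices.
\<close>

definition hankel_submatrix :: "int \<Rightarrow> nat \<Rightarrow> (nat \<Rightarrow> int) \<Rightarrow> (nat \<Rightarrow> int) \<Rightarrow> cpoly mat" where
  "hankel_submatrix \<alpha> n f g = mat n n (\<lambda>(i, j). cconst ((-1) powi \<alpha>) * cvar (\<alpha> + f i + g j))"

lemma index_hankel_submatrix:
  "r < n \<Longrightarrow> s < n \<Longrightarrow> hankel_submatrix \<alpha> n f g $$ (r, s) = cconst ((-1) powi \<alpha>) * cvar (\<alpha> + f r + g s)"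
  by (simp add: hankel_submatrix_def)

lemma mat_delete_hankel_submatrix:
  "r < Suc n \<Longrightarrow> s < Suc n \<Longrightarrow> mat_delete (hankel_submatrix \<alpha> (Suc n) f g) r s =
     hankel_submatrix \<alpha> n (\<lambda>i. f (insert_index r i)) (\<lambda>i. g (insert_index s i))"
  by (auto simp: mat_delete_def hankel_submatrix_def insert_index_def)

text \<open>
  Summing the Laplace expansions along all \<open>n\<close> rows. A power of the current does not single out a
  row, so it is this symmetric form that its recursion reproduces; the factors \<open>n\<close> accumulate to
  the \<open>n!\<close> which the exponential series cancels.
\<close>

lemma det_full_expansion:
  assumes "A \<in> carrier_mat n n"
  shows "of_nat n * det A = (\<Sum>r<n. \<Sum>s<n. (-1) ^ (r + s) * (A $$ (r, s) * det (mat_delete A r s)))"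
proof -
  have "(\<Sum>s<n. (-1) ^ (r + s) * (A $$ (r, s) * det (mat_delete A r s))) = det A" if "r < n" for r
    using laplace_expansion_row[OF assms that] by (simp add: cofactor_def mult.left_commute)
  then show ?thesis by simp
qed

text \<open>
  Induction on \<open>N\<close>. The adjoint of one factor of the current is two contractions, which turn
  the excitation into the sum over \<open>r, s\<close> of those with \<open>f r\<close> and \<open>g s\<close> removed, with the signs and
  coefficients of the full Laplace expansion. Arbitrary \<open>f\<close> and \<open>g\<close> are needed because the induction
  descends to all minors. The sign \<open>(-1)\<^bsup>0 + 1 + \<cdots> + (n - 1)\<^esup>\<close> collects the signs \<open>(-1)\<^sup>n\<close> of the
  single steps. If \<open>N \<noteq> n\<close>, the recursion ends with a fermion that kills the vacuum.
\<close>

theorem coord_form_current_power: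
  assumes "\<And>i. 0 \<le> f i" "\<And>i. 0 \<le> g i"
  shows "coord_form (excitation n f g) ((current \<alpha> ^^ N) (fock_const vac) \<mu>) =
    (if N = n then (-1) ^ (\<Sum>{..<n}) * fact n * Poly_Mapping.lookup (det (hankel_submatrix \<alpha> n f g)) \<mu> else 0)"
  using assms
proof (induction N arbitrary: n f g \<mu>)
  case 0
  show ?case
  proof (cases n)
    case 0
    have "det (hankel_submatrix \<alpha> 0 f g) = 1" by (rule det_dim_zero) (simp add: hankel_submatrix_def)
    then show ?thesis using 0
      by (simp add: excitation_def fock_const_def lookup_one when_def coord_form_linear)
        (simp add: vac_def coord_form_ket)
  next
    case (Suc k)
    have "coord_form (excitation n f g) vac = 0"
      using 0 unfolding Suc excitation_def fermion_prod.simps psi_field_def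
      by (subst coord_form_sym)
        (simp add: psi_adjoint[of _ Cre] psi_vac coord_form_linear del: psi.simps)
    then show ?thesis using Suc by (simp add: fock_const_def coord_form_linear)
  qed
next
  case (Suc N)
  note IH = Suc.IH and nonneg = Suc.prems
  let ?u = "(current \<alpha> ^^ N) (fock_const vac)"
  have u: "?u \<nu> \<in> half_vacuum" for \<nu> by (rule current_power_half_vacuum)
  \<comment> \<open>The leftmost current at \<open>\<mu>\<close> divides \<open>\<mu>\<close> by one variable; its two fermions go to the other side
    of the form.\<close>
  have expand: "coord_form w ((current \<alpha> ^^ Suc N) (fock_const vac) \<mu>) =
      (\<Sum>i\<in>Poly_Mapping.keys \<mu>. (-1) powi \<alpha> * (\<Sum>q\<in>{0..i - \<alpha>}.
         coord_form (psi Cre 0 (i - \<alpha> - q) (psi Ann 1 q w)) (?u (\<mu> - Poly_Mapping.single i 1))))" for w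
    unfolding funpow.simps o_apply current_eq[of \<alpha> ?u]
    by (simp only: coord_form_linear coord_form_field_mult[OF u])
  show ?case
  proof (cases n)
    case 0
    then show ?thesis unfolding expand
      by (simp add: excitation_def psi_vac coord_form_linear del: psi.simps)
  next
    case (Suc k)
    let ?f = "\<lambda>r i. f (insert_index r i)" and ?g = "\<lambda>s i. g (insert_index s i)"
    let ?B = "\<lambda>r s \<nu>. coord_form (excitation k (?f r) (?g s)) (?u \<nu>)"
    let ?\<mu> = "\<lambda>i. \<mu> - Poly_Mapping.single i 1"
    let ?c = "(-1) powi \<alpha> :: complex"
    have B: "?B r s \<nu> = (if N = k then (-1) ^ (\<Sum>{..<k}) * fact k *
        Poly_Mapping.lookup (det (hankel_submatrix \<alpha> k (?f r) (?g s))) \<nu> else 0)" for r s \<nu>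
      by (rule IH) (rule nonneg)+
    \<comment> \<open>The sum over the modes of the current selects \<open>q = f r\<close>; since \<open>f r\<close> and \<open>g s\<close> are nonnegative,
      it lies in the range \<open>{0..d}\<close> as soon as \<open>f r + g s = d\<close>.\<close>
    have inner: "(\<Sum>q\<in>{0..d}. coord_form (psi Cre 0 (d - q) (psi Ann 1 q (excitation n f g))) v) =
        (\<Sum>r<Suc k. \<Sum>s<Suc k. if f r + g s = d
           then (-1) ^ (k + r + s) * coord_form (excitation k (?f r) (?g s)) v else 0)" for d v
    proof -
      have "(\<Sum>q\<in>{0..d}. coord_form (psi Cre 0 (d - q) (psi Ann 1 q (excitation n f g))) v) =
          (\<Sum>q\<in>{0..d}. \<Sum>r<Suc k. \<Sum>s<Suc k. (if f r = q \<and> g s = d - q then (-1) ^ (k + r + s) else 0) *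
             coord_form (excitation k (?f r) (?g s)) v)"
        unfolding Suc
        by (intro sum.cong refl, subst two_contractions_excitation) (auto simp only: coord_form_linear atLeastAtMost_iff diff_ge_0_iff_ge)
      also have "\<dots> = (\<Sum>r<Suc k. \<Sum>s<Suc k. \<Sum>q\<in>{0..d}. (if f r = q \<and> g s = d - q then (-1) ^ (k + r + s) else 0) *
             coord_form (excitation k (?f r) (?g s)) v)"
        by (subst sum.swap, intro sum.cong refl, subst sum.swap, rule refl)
      also have "\<dots> = (\<Sum>r<Suc k. \<Sum>s<Suc k. \<Sum>q\<in>{0..d}. if q = f r then
             (if f r + g s = d then (-1) ^ (k + r + s) * coord_form (excitation k (?f r) (?g s)) v else 0) else 0)"
        by (intro sum.cong refl) auto
      also have "\<dots> = (\<Sum>r<Suc k. \<Sum>s<Suc k. if f r + g s = d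
           then (-1) ^ (k + r + s) * coord_form (excitation k (?f r) (?g s)) v else 0)"
        using nonneg by (intro sum.cong refl, subst sum.delta) (auto simp: add_increasing2 dest: sym)
      finally show ?thesis .
    qed
    have "coord_form (excitation n f g) ((current \<alpha> ^^ Suc N) (fock_const vac) \<mu>) =
        (\<Sum>i\<in>Poly_Mapping.keys \<mu>. \<Sum>r<Suc k. \<Sum>s<Suc k.
           if \<alpha> + f r + g s = i then ?c * ((-1) ^ (k + r + s) * ?B r s (?\<mu> i)) else 0)"
      unfolding expand inner sum_distrib_left by (intro sum.cong refl) (auto simp: algebra_simps)
    also have "\<dots> = (\<Sum>r<Suc k. \<Sum>s<Suc k. \<Sum>i\<in>Poly_Mapping.keys \<mu>.
           if \<alpha> + f r + g s = i then ?c * ((-1) ^ (k + r + s) * ?B r s (?\<mu> i)) else 0)"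
      by (subst sum.swap, intro sum.cong refl, subst sum.swap, rule refl)
    also have "\<dots> = (\<Sum>r<Suc k. \<Sum>s<Suc k. if \<alpha> + f r + g s \<in> Poly_Mapping.keys \<mu>
           then ?c * ((-1) ^ (k + r + s) * ?B r s (?\<mu> (\<alpha> + f r + g s))) else 0)"
      by (simp add: sum.delta' del: sum.lessThan_Suc)
    \<comment> \<open>Multiplication by the variable \<open>c\<close> with index \<open>\<alpha> + f r + g s\<close> is the shift of exponents on the
      left, so the sum is a coefficient of the Laplace expansion.\<close>
    also have "\<dots> = (if N = k then (-1) ^ (\<Sum>{..<n}) * fact k * Poly_Mapping.lookup
        (\<Sum>r<n. \<Sum>s<n. (-1) ^ (r + s) * (hankel_submatrix \<alpha> n f g $$ (r, s) *
           det (mat_delete (hankel_submatrix \<alpha> n f g) r s))) \<mu> else 0)"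
    proof (cases "N = k")
      case False
      show ?thesis unfolding B if_not_P[OF False] by (simp cong: if_cong)
    next
      case True
      have sgn: "(-1) ^ m * p = cconst ((-1) ^ m) * p" for m and p :: cpoly
        by (cases "even m") (simp_all add: cconst_def single_uminus)
      show ?thesis
        unfolding B Suc lookup_sum sum_distrib_left if_P[OF True]
        by (intro sum.cong refl)
          (auto simp: sgn lookup_cconst_mult lookup_cvar_mult mat_delete_hankel_submatrix index_hankel_submatrix
             mult.assoc power_add)
    qed
    also have "(\<Sum>r<n. \<Sum>s<n. (-1) ^ (r + s) * (hankel_submatrix \<alpha> n f g $$ (r, s) *
           det (mat_delete (hankel_submatrix \<alpha> n f g) r s))) = of_nat n * det (hankel_submatrix \<alpha> n f g)"
      by (rule det_full_expansion[symmetric]) (simp add: hankel_submatrix_def)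
    also have "of_nat n * det (hankel_submatrix \<alpha> n f g) = cconst (of_nat n) * det (hankel_submatrix \<alpha> n f g)"
      by (simp add: cconst_def single_of_nat)
    finally show ?thesis using Suc by (simp add: lookup_cconst_mult)
  qed
qed

section \<open>Powers of the translation operator on the vacuum\<close>

lemma Q_op_eq: "Q_op = shift_op"
  using is_translation_Q_op is_translation_shift_op ex1_translation by blast

lemma bij_T: "bij T_op"
  unfolding T_op_def Q_op_eq by (intro bij_comp bij_imp_bij_inv bij_shift_op)

lemma linear_T: "T_op (fscale c v) = fscale c (T_op v)" "T_op 0 = 0" "T_op (- v) = - T_op v"
proof -
  have inv: "inv_into UNIV (shift_op 0) (fscale c v) = fscale c (inv_into UNIV (shift_op 0) v)" for c v
    by (intro inv_f_eq) (simp_all add: fock_lin bij_shift_op bij_is_inj bij_is_surj surj_f_inv_f)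
  show scale: "T_op (fscale c v) = fscale c (T_op v)" for c v
    by (simp add: T_op_def Q_op_eq inv fock_lin)
  show "T_op 0 = 0" "T_op (- v) = - T_op v" using scale[of 0 0] scale[of "-1" v] by simp_all
qed

text \<open>
  One of \<open>Q\<^sub>1\<close> and \<open>Q\<^sub>0\<^sup>-\<^sup>1\<close> anticommutes with the fermion and the other shifts its mode, so there is always
  one sign and one shift, in opposite directions for the two components.
\<close>

lemma T_psi: "T_op (psi s a k v) =
    - psi s a (if a = 0 then k + charge_val s else k - charge_val s) (T_op v)"
proof -
  define w where "w = inv_into UNIV (shift_op 0) v"
  have v: "v = shift_op 0 w" by (simp add: w_def bij_shift_op bij_is_surj surj_f_inv_f)
  have inv: "inv_into UNIV (shift_op 0) (shift_op 0 x) = x" for x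
    by (simp add: bij_shift_op bij_is_inj)
  have shift_neg: "shift_op b (- x) = - shift_op b x" for b x
    using linear_zero_scale(2)[OF linear_shift_op, of b "-1" x] by simp
  have T: "T_op (shift_op 0 x) = shift_op 1 x" for x
    by (simp add: T_op_def Q_op_eq inv)
  consider "a = 0" | "a = 1" using two_cases by blast
  then show ?thesis
  proof cases
    case 1
    then show ?thesis
      using psi_shift_op[of s 0 k 0 w] psi_shift_op[of s 0 "k + charge_val s" 1 w]
      by (simp add: v T del: psi.simps)
  next
    case 2
    have "psi s 1 k (shift_op 0 w) = shift_op 0 (- psi s 1 k w)"
      using psi_shift_op[of s 1 k 0 w] by (simp add: shift_neg del: psi.simps)
    moreover have "psi s 1 (k - charge_val s) (shift_op 1 w) = shift_op 1 (psi s 1 k w)"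
      using psi_shift_op[of s 1 "k - charge_val s" 1 w] by (simp del: psi.simps)
    ultimately show ?thesis using 2 by (simp add: v T linear_T shift_neg del: psi.simps)
  qed
qed

lemma T_fermion_prod:
  assumes "(s, a) = (Cre, 1) \<or> (s, a) = (Ann, 0)"
  shows "T_op (fermion_prod s a n f v) = fscale ((-1) ^ n) (fermion_prod s a n (\<lambda>i. f i + 1) (T_op v))"
proof (induction n arbitrary: f)
  case (Suc n)
  show ?case using assms Suc.IH[of "\<lambda>i. f (Suc i)"]
    by (auto simp: psi_field_def T_psi psi_scale simp del: psi.simps)
qed simp

lemma T_vac: "T_op vac = psi_field Cre 1 0 (psi_field Ann 0 0 vac)"
proof -
  have "psi Ann 0 0 (shift_op 0 vac) = shift_op 0 (psi Ann 0 (- 1) vac)"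
    using psi_shift_op[of Ann 0 0 0 vac] by (simp del: psi.simps)
  moreover have "psi Ann 0 0 (shift_op 0 vac) = vac"
    unfolding shift_op_vac by (simp add: psi_pass[of Ann 0 0] psi_vac del: psi.simps)
  ultimately have "inv_into UNIV (shift_op 0) vac = psi Ann 0 (-1) vac"
    by (intro inv_f_eq) (simp_all add: bij_shift_op bij_is_inj del: psi.simps)
  then have "T_op vac = shift_op 1 (psi Ann 0 (-1) vac)" by (simp add: T_op_def Q_op_eq)
  also have "\<dots> = - psi Ann 0 (-1) (psi Cre 1 (-1) vac)"
    using psi_shift_op[of Ann 0 "-1" 1 vac] by (simp add: shift_op_vac del: psi.simps)
  also have "\<dots> = psi Cre 1 (-1) (psi Ann 0 (-1) vac)"
    by (simp add: psi_pass[of Ann 0 "-1" Cre] del: psi.simps)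
  finally show ?thesis by (simp add: psi_field_def)
qed

text \<open>
  Applying \<open>T\<close> raises the indices of all fermions by one, and \<open>T v\<^sub>0\<close> supplies the new pair with index 0. The
  fermion of component 1 passes an even number of factors on its way to the front; that of
  component 0 passes the \<open>k\<close> factors of its own component, whence the sign.
\<close>

lemma T_power_vac: "T_power (int k) vac = fscale ((-1) ^ (\<Sum>{..<k})) (excitation k int int)"
proof (induction k)
  case 0
  show ?case by (simp add: T_power_def excitation_def)
next
  case (Suc k)
  let ?g = "\<lambda>i. int i + 1"
  have "T_power (int (Suc k)) vac = T_op (T_power (int k) vac)"
    by (simp add: T_power_def nat_add_distrib)
  also have "\<dots> = fscale ((-1) ^ (\<Sum>{..<k})) (fermion_prod Cre 1 k ?g (fermion_prod Ann 0 k ?g (T_op vac)))"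
    unfolding Suc linear_T excitation_def
    by (simp add: T_fermion_prod fermion_prod_scale flip: power_add)
  also have "\<dots> = fscale ((-1) ^ (\<Sum>{..<Suc k})) (excitation (Suc k) int int)"
    unfolding excitation_def fermion_prod.simps(2) T_vac psi_field_def[of _ _ 0] psi_field_def[of _ _ "int 0"]
    by (simp add: psi_fermion_prod_other psi_scale fermion_prod_scale power_add mult.assoc add.commute del: psi.simps)
  finally show ?case .
qed

text \<open>
  In \<open>T\<^bsup>-j\<^esup> v\<^sub>0\<close> all modes of component 0 from \<open>e\<^sub>0 z\<^bsup>-j\<^esup>\<close> on are filled, so wedging with one of them
  gives zero. Applying \<open>T\<close> shifts the mode up by one and reduces this to the previous power.
\<close>

lemma psi_Cre_T_power_neg:
  assumes "- int j \<le> k"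
  shows "psi Cre 0 k ((inv_into UNIV T_op ^^ j) vac) = 0"
  using assms
proof (induction j arbitrary: k)
  case 0
  then show ?case by (simp add: psi_vac del: psi.simps)
next
  case (Suc j)
  let ?v = "(inv_into UNIV T_op ^^ j) vac"
  have "T_op (psi Cre 0 k (inv_into UNIV T_op ?v)) = - psi Cre 0 (k + 1) ?v"
    by (simp add: T_psi bij_T bij_is_surj surj_f_inv_f del: psi.simps)
  also have "\<dots> = T_op 0" using Suc by (simp add: linear_T del: psi.simps)
  finally show ?case using bij_T by (simp add: bij_def inj_eq del: psi.simps)
qed

text \<open>
  \<open>T\<^sup>k v\<^sub>0\<close> has the factor \<open>e\<^sub>0 z\<^sup>-\<^sup>1\<close> when \<open>k < 0\<close>, whereas the wedges occurring in \<open>v\<close> do not.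
\<close>

lemma coord_form_T_power_neg:
  assumes "k < 0" "v \<in> half_vacuum"
  shows "coord_form (T_power k vac) v = 0"
proof -
  have "psi Cre 0 (-1) (T_power k vac) = 0"
    using assms psi_Cre_T_power_neg[of "nat (- k)" "-1"] by (simp add: T_power_def del: psi.simps)
  \<comment> \<open>By the anticommutator, a vector killed by a fermion is in its image.\<close>
  then have "T_power k vac = psi Cre 0 (-1) (psi Ann 0 0 (T_power k vac))"
    by (simp add: psi_pass[of Cre 0 "-1"] del: psi.simps)
  then have "coord_form (T_power k vac) v = coord_form v (psi Cre 0 (-1) (psi Ann 0 0 (T_power k vac)))"
    by (simp add: coord_form_sym)
  also have "\<dots> = 0"
    using assms by (simp add: psi_adjoint[of _ Cre] half_vacuum_def coord_form_linear del: psi.simps)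
  finally show ?thesis .
qed

section \<open>The \<open>\<tau>\<close>-functions as determinants\<close>

lemma coord_form_g_op:
  "coord_form w (g_op \<alpha> v \<mu>) = Sum_any (\<lambda>n. coord_form w ((current \<alpha> ^^ n) (fock_const v) \<mu>) / fact n)"
proof -
  have "coord_form w (g_op \<alpha> v \<mu>) =
     (\<Sum>n\<in>{n. fscale (1 / fact n) ((current \<alpha> ^^ n) (fock_const v) \<mu>) \<noteq> 0}.
       coord_form w ((current \<alpha> ^^ n) (fock_const v) \<mu>) / fact n)"
    unfolding g_op_def Sum_any.expand_set by (simp add: coord_form_linear)
  also have "\<dots> = Sum_any (\<lambda>n. coord_form w ((current \<alpha> ^^ n) (fock_const v) \<mu>) / fact n)"
    by (rule Sum_any.expand_superset[symmetric, OF finite_exp]) (auto simp: coord_form_linear)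
  finally show ?thesis .
qed

theorem tau_neg: "k < 0 \<Longrightarrow> tau k \<alpha> = ser_of_poly 0"
  by (simp add: fun_eq_iff tau_def wedge_form_eq coord_form_g_op coord_form_T_power_neg
      current_power_half_vacuum ser_of_poly_def)

theorem tau_nonneg: "tau (int k) \<alpha> = ser_of_poly (det (hankel_submatrix \<alpha> k int int))"
proof
  fix \<mu>
  have *: "coord_form (excitation k int int) ((current \<alpha> ^^ n) (fock_const vac) \<mu>) / fact n =
      (if n = k then (-1) ^ (\<Sum>{..<k}) * Poly_Mapping.lookup (det (hankel_submatrix \<alpha> k int int)) \<mu> else 0)" for n
    by (subst coord_form_current_power) auto
  have "tau (int k) \<alpha> \<mu> = (-1) ^ (\<Sum>{..<k}) * coord_form (excitation k int int) (g_op \<alpha> vac \<mu>)"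
    unfolding tau_def wedge_form_eq T_power_vac coord_form_linear ..
  also have "\<dots> = ser_of_poly (det (hankel_submatrix \<alpha> k int int)) \<mu>"
    unfolding coord_form_g_op * by (simp add: ser_of_poly_def flip: mult.assoc power_add)
  finally show "tau (int k) \<alpha> \<mu> = ser_of_poly (det (hankel_submatrix \<alpha> k int int)) \<mu>" .
qed

section \<open>The Vandermonde determinant\<close>

lemma det_mat:
  "det (mat n n (\<lambda>(i, j). a i j)) = (\<Sum>p | p permutes {0..<n}. of_int (sign p) * (\<Prod>i<n. a i (p i)))"
proof -
  have "(\<Prod>i = 0..<n. mat n n (\<lambda>(i, j). a i j) $$ (i, p i)) = (\<Prod>i<n. a i (p i))" if "p permutes {0..<n}" for p
    unfolding lessThan_atLeast0 using permutes_in_image[OF that] by (intro prod.cong refl) simp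
  then show ?thesis by (subst det_def'[OF mat_carrier]) simp
qed

text \<open>
  Subtracting \<open>x 0\<close> times each column from the next one, that is, multiplying by the unitriangular
  matrix \<open>?B\<close>, turns the first row into \<open>(1, 0, \<dots>, 0)\<close>; in the remaining minor the row \<open>i\<close> has the
  factor \<open>x (i + 1) - x 0\<close>. This argument needs no division, so it applies to Laurent polynomials.
\<close>

lemma det_vandermonde:
  fixes x :: "nat \<Rightarrow> 'a :: comm_ring_1"
  shows "det (mat n n (\<lambda>(i, j). x i ^ j)) = (\<Prod>j<n. \<Prod>i<j. x j - x i)"
proof (induction n arbitrary: x)
  case 0
  show ?case by (simp add: det_dim_zero)
next
  case (Suc n)
  let ?A = "mat (Suc n) (Suc n) (\<lambda>(i, j). x i ^ j)"
  let ?B = "mat (Suc n) (Suc n) (\<lambda>(i, j). if i = j then 1 else if Suc i = j then - x 0 else 0)"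
  let ?V = "mat n n (\<lambda>(i, j). x (Suc i) ^ j)"
  have AB: "?A \<in> carrier_mat (Suc n) (Suc n)" "?B \<in> carrier_mat (Suc n) (Suc n)" by auto
  define M where "M = ?A * ?B"
  have M: "M \<in> carrier_mat (Suc n) (Suc n)" unfolding M_def by (rule mult_carrier_mat[OF AB])
  have entry: "M $$ (i, j) = (if j = 0 then 1 else x i ^ (j - 1) * (x i - x 0))"
    if "i < Suc n" "j < Suc n" for i j
  proof -
    have "M $$ (i, j) =
        (\<Sum>l = 0..<Suc n. x i ^ l * (if l = j then 1 else if Suc l = j then - x 0 else 0))"
      using that unfolding M_def by (simp add: scalar_prod_def del: sum.op_ivl_Suc)
    also have "\<dots> = (\<Sum>l = 0..<Suc n. (if l = j then x i ^ l else 0) +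
        (if 0 < j \<and> l = j - 1 then - (x i ^ l * x 0) else 0))"
      by (intro sum.cong refl) auto
    also have "\<dots> = (if j = 0 then 1 else x i ^ (j - 1) * (x i - x 0))"
      using that by (cases j) (auto simp: sum.distrib algebra_simps simp del: sum.op_ivl_Suc)
    finally show ?thesis .
  qed
  have "det ?B = 1"
  proof (subst det_upper_triangular[OF _ AB(2)])
    have "diag_mat ?B = replicate (Suc n) 1"
      by (rule nth_equalityI) (auto simp: diag_mat_def simp del: upt_Suc replicate_Suc)
    then show "prod_list (diag_mat ?B) = 1" by (simp only: prod_list_replicate power_one)
  qed (auto simp: upper_triangular_def)
  then have "det ?A = det M" using det_mult[OF AB] by (simp add: M_def)
  also have "\<dots> = (\<Sum>j<Suc n. M $$ (0, j) * cofactor M 0 j)"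
    by (rule laplace_expansion_row[OF M]) simp
  also have "\<dots> = (\<Sum>j<Suc n. if j = 0 then cofactor M 0 0 else 0)"
    by (intro sum.cong refl) (auto simp: entry)
  also have "\<dots> = det (mat_delete M 0 0)"
    by (simp add: cofactor_def sum.lessThan_Suc_shift)
  also have "mat_delete M 0 0 = mat n n (\<lambda>(i, j). (x (Suc i) - x 0) * x (Suc i) ^ j)"
    by (rule eq_matI) (use M in \<open>auto simp: mat_delete_def entry mult.commute\<close>)
  also have "det \<dots> = (\<Prod>i<n. x (Suc i) - x 0) * det ?V"
    by (simp add: det_mat prod.distrib sum_distrib_left mult_ac)
  also have "\<dots> = (\<Prod>j<n. (x (Suc j) - x 0) * (\<Prod>i<j. x (Suc j) - x (Suc i)))"
    by (simp add: Suc.IH prod.distrib)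
  also have "\<dots> = (\<Prod>j<Suc n. \<Prod>i<j. x j - x i)"
    by (simp add: prod.lessThan_Suc_shift del: prod.lessThan_Suc)
  finally show ?case .
qed

section \<open>Residues in several variables\<close>

lemma foldr_Res_var:
  assumes "distinct xs" "\<And>i. i \<in> set xs \<Longrightarrow> Poly_Mapping.lookup m i = 0"
  shows "foldr Res_var xs s m = s (m + (\<Sum>i\<in>set xs. Poly_Mapping.single i (-1)))"
  using assms
proof (induction xs arbitrary: m)
  case (Cons x xs)
  have "foldr Res_var xs s (m + Poly_Mapping.single x (-1)) =
      s (m + Poly_Mapping.single x (-1) + (\<Sum>i\<in>set xs. Poly_Mapping.single i (-1)))"
    using Cons.prems by (intro Cons.IH) (auto simp: lookup_add lookup_single when_def)
  then show ?case using Cons.prems by (simp add: Res_var_def[of x] add.assoc)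
qed simp

lemma Res_all_eq: "Res_all k s = s (\<Sum>i = 1..k. Poly_Mapping.single i (-1))"
  by (simp add: Res_all_def foldr_Res_var atLeastLessThanSuc_atLeastAtMost del: upt_Suc)

lemma wmult_superset:
  assumes "finite A" "Poly_Mapping.keys q \<subseteq> A"
  shows "wmult s q m = (\<Sum>d\<in>A. s (m - d) * Poly_Mapping.lookup q d)"
  unfolding wmult_def using assms by (intro sum.mono_neutral_left) (auto simp: in_keys_iff)

lemma wmult_add: "wmult s (p + q) m = wmult s p m + wmult s q m"
proof -
  have "Poly_Mapping.keys (p + q) \<subseteq> Poly_Mapping.keys p \<union> Poly_Mapping.keys q"
    by (rule Poly_Mapping.keys_add)
  then show ?thesis
    by (subst (1 2 3) wmult_superset[of "Poly_Mapping.keys p \<union> Poly_Mapping.keys q"])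
      (auto simp: lookup_add algebra_simps sum.distrib)
qed

lemma wmult_sum: "finite A \<Longrightarrow> wmult s (sum F A) m = (\<Sum>x\<in>A. wmult s (F x) m)"
  by (induction A rule: finite_induct) (simp_all add: wmult_add, simp add: wmult_def)

lemma wmult_single: "wmult s (Poly_Mapping.single d c) m = s (m - d) * c"
  by (subst wmult_superset[of "{d}"]) auto

lemma prod_single: "finite A \<Longrightarrow>
    (\<Prod>i\<in>A. Poly_Mapping.single (d i) (c i)) = Poly_Mapping.single (\<Sum>i\<in>A. d i) (\<Prod>i\<in>A. c i :: 'b :: comm_semiring_1)"
  for d :: "'i \<Rightarrow> 'a :: comm_monoid_add"
  by (induction A rule: finite_induct) (simp_all add: mult_single)

lemma wvar_power: "wvar i ^ n = Poly_Mapping.single (Poly_Mapping.single i (int n)) 1"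
  by (induction n) (simp_all add: wvar_def mult_single single_add[symmetric])

lemma sq_vandermonde_eq_det:
  "sq_vandermonde k = det (mat k k (\<lambda>(i, j). wvar (Suc i) ^ j)) ^ 2"
proof -
  have "sq_vandermonde k = (\<Prod>(j, i)\<in>Sigma {..<k} lessThan. (wvar (Suc i) - wvar (Suc j)) ^ 2)"
    unfolding sq_vandermonde_def
    by (rule prod.reindex_bij_witness[of _ "\<lambda>(j, i). (Suc i, Suc j)" "\<lambda>(i, j). (j - 1, i - 1)"]) auto
  also have "\<dots> = (\<Prod>j<k. \<Prod>i<j. (wvar (Suc j) - wvar (Suc i)) ^ 2)"
    by (simp add: prod.Sigma power2_commute)
  finally show ?thesis by (simp add: det_vandermonde prod_power_distrib)
qed

lemma Res_wvar_monomial: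
  "Res_all k (wmult (separate_prod k D) (Poly_Mapping.single (\<Sum>i<k. Poly_Mapping.single (Suc i) (int (n i))) c)) =
     (\<Prod>i<k. D (- 1 - int (n i))) * c"
proof -
  define m where "m = (\<Sum>i = 1..k. Poly_Mapping.single i (-1)) - (\<Sum>i<k. Poly_Mapping.single (Suc i) (int (n i)))"
  have "(\<Sum>i = 1..k. Poly_Mapping.single i (-1 :: int)) = (\<Sum>i<k. Poly_Mapping.single (Suc i) (-1))"
    by (rule sum.reindex_bij_witness[of _ Suc "\<lambda>i. i - 1"]) auto
  then have m: "m = (\<Sum>i<k. Poly_Mapping.single (Suc i) (- 1 - int (n i)))"
    by (simp only: m_def sum_subtractf[symmetric] single_diff[symmetric])
  have lookup: "Poly_Mapping.lookup m j = (\<Sum>i<k. if Suc i = j then - 1 - int (n i) else 0)" for j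
    unfolding m by (simp add: lookup_sum lookup_single when_def)
  have "Poly_Mapping.keys m \<subseteq> {1..k}"
  proof
    fix j assume "j \<in> Poly_Mapping.keys m"
    then have "(\<Sum>i<k. if Suc i = j then - 1 - int (n i) else 0) \<noteq> 0" unfolding in_keys_iff lookup .
    then obtain i where "i \<in> {..<k}" "(if Suc i = j then - 1 - int (n i) else 0) \<noteq> 0"
      by (rule sum.not_neutral_contains_not_neutral)
    then show "j \<in> {1..k}" by (auto split: if_splits)
  qed
  moreover have "(\<Prod>j = 1..k. D (Poly_Mapping.lookup m j)) = (\<Prod>i<k. D (- 1 - int (n i)))"
    by (rule sym, rule prod.reindex_bij_witness[of _ "\<lambda>j. j - 1" Suc]) (auto simp: lookup)
  ultimately show ?thesis
    by (simp only: Res_all_eq wmult_single separate_prod_def if_True m_def[symmetric])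
qed

lemma Res_all_wmult_sum: "finite A \<Longrightarrow> Res_all k (wmult s (sum F A)) = (\<Sum>x\<in>A. Res_all k (wmult s (F x)))"
  by (simp add: Res_all_eq wmult_sum)

text \<open>
  Expanding both Vandermonde determinants gives a double sum over permutations \<open>p, q\<close>, in which the
  residue of \<open>\<Prod>\<^sub>i D(w\<^sub>i) w\<^sub>i\<^bsup>p i + q i\<^esup>\<close> is a product of coefficients of \<open>D\<close>. For fixed \<open>p\<close> the sum over
  \<open>q\<close> is the Hankel determinant with its rows permuted by \<open>p\<close>; the sign of this permutation cancels
  the sign of \<open>p\<close>, so each of the \<open>k!\<close> permutations \<open>p\<close> contributes the same determinant.
\<close>

lemma Res_sq_vandermonde:
  "Res_all k (wmult (separate_prod k D) (sq_vandermonde k)) =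
     of_nat (fact k) * det (mat k k (\<lambda>(i, j). D (- 1 - int (i + j))))"
proof -
  let ?P = "{p. p permutes {0..<k}}"
  let ?W = "mat k k (\<lambda>(i, j). wvar (Suc i) ^ j)"
  define H where "H = mat k k (\<lambda>(i, j). D (- 1 - int (i + j)))"
  have H: "H \<in> carrier_mat k k" by (simp add: H_def)
  have fin: "finite ?P" by (rule finite_permutations) simp
  have lt: "p i < k" if "p \<in> ?P" "i < k" for p i
    using that permutes_in_image[of p "{0..<k}" i] by simp
  let ?mon = "\<lambda>p q. Poly_Mapping.single (\<Sum>i<k. Poly_Mapping.single (Suc i) (int (p i + q i)))
      (of_int (sign p) * of_int (sign q)) :: wpoly"
  have "det ?W = (\<Sum>p\<in>?P. Poly_Mapping.single (\<Sum>i<k. Poly_Mapping.single (Suc i) (int (p i))) (of_int (sign p)))"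
    by (simp add: det_mat wvar_power prod_single mult_single flip: single_of_int)
  then have "sq_vandermonde k = (\<Sum>p\<in>?P. \<Sum>q\<in>?P. ?mon p q)"
    unfolding sq_vandermonde_eq_det power2_eq_square
    by (simp only: sum_product mult_single of_nat_add single_add sum.distrib)
  then have "Res_all k (wmult (separate_prod k D) (sq_vandermonde k)) =
      (\<Sum>p\<in>?P. \<Sum>q\<in>?P. (\<Prod>i<k. D (- 1 - int (p i + q i))) * (of_int (sign p) * of_int (sign q)))"
    by (simp only: Res_all_wmult_sum[OF fin] Res_wvar_monomial)
  also have "\<dots> = (\<Sum>p\<in>?P. of_int (sign p) *
      (\<Sum>q\<in>?P. of_int (sign q) * (\<Prod>i<k. D (- 1 - int (p i + q i)))))"
    unfolding sum_distrib_left by (intro sum.cong refl) (simp only: mult_ac)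
  also have "\<dots> = (\<Sum>p\<in>?P. of_int (sign p) * det (mat k k (\<lambda>(i, j). H $$ (p i, j))))"
    unfolding det_mat by (intro sum.cong refl arg_cong2[where f = "(*)"] prod.cong) (auto simp: H_def lt)
  also have "\<dots> = (\<Sum>p\<in>?P. det H)"
  proof (intro sum.cong refl)
    fix p assume "p \<in> ?P"
    then have "det (mat k k (\<lambda>(i, j). H $$ (p i, j))) = of_int (sign p) * det H"
      by (intro det_permute_rows[OF H]) simp
    moreover have "of_int (sign p) * of_int (sign p) = (1 :: cpoly)"
      by (simp flip: of_int_mult add: sign_idempotent)
    ultimately show "of_int (sign p) * det (mat k k (\<lambda>(i, j). H $$ (p i, j))) = det H"
      by (simp add: mult.assoc[symmetric])
  qed
  also have "\<dots> = of_nat (fact k) * det H"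
    by (simp add: card_permutations[of "{0..<k}"])
  finally show ?thesis by (simp add: H_def)
qed

section \<open>The residue formula and the Hankel determinant\<close>

lemma C_alpha_eq: "C_alpha \<alpha> (- 1 - int n) = cconst ((-1) powi \<alpha>) * cvar (\<alpha> + int n)"
  by (simp add: C_alpha_def w_times_def C_series_def algebra_simps)

lemma Res_hankel:
  "cconst (1 / fact k) * Res_all k (wmult (separate_prod k (C_alpha \<alpha>)) (sq_vandermonde k)) =
     det (hankel_submatrix \<alpha> k int int)"
proof -
  have "mat k k (\<lambda>(i, j). C_alpha \<alpha> (- 1 - int (i + j))) = hankel_submatrix \<alpha> k int int"
    unfolding C_alpha_eq hankel_submatrix_def by (simp add: add.assoc)
  moreover have "cconst (1 / fact k) * of_nat (fact k) = 1"
    by (simp add: cconst_def mult_single flip: single_of_nat)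
  ultimately show ?thesis
    unfolding Res_sq_vandermonde by (simp only: mult.assoc[symmetric] mult_1_left)
qed

lemma det_hankel:
  "det (hankel_submatrix \<alpha> k int int) =
     cconst ((-1) powi (int k * \<alpha>)) * det (mat k k (\<lambda>(i, j). cvar (\<alpha> + int i + int j)))"
proof -
  have "hankel_submatrix \<alpha> k int int = cconst ((-1) powi \<alpha>) \<cdot>\<^sub>m mat k k (\<lambda>(i, j). cvar (\<alpha> + int i + int j))"
    by (rule eq_matI) (auto simp: hankel_submatrix_def)
  moreover have "cconst c ^ k = cconst (c ^ k)" for c
    by (induction k) (simp_all add: cconst_def mult_single)
  moreover have "((-1) powi \<alpha>) ^ k = ((-1) powi (int k * \<alpha>) :: complex)"
    by (simp add: mult.commute[of "int k"] power_int_mult)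
  ultimately show ?thesis by simp
qed

theorem theorem2p1:
  fixes \<alpha> :: int
  shows "(\<forall>k::int. k < 0 \<longrightarrow> tau k \<alpha> = ser_of_poly 0) \<and>
    tau 0 \<alpha> = ser_of_poly 1 \<and>
    (\<forall>k::nat. 0 < k \<longrightarrow>
       tau (int k) \<alpha> = ser_of_poly (cconst (1 / fact k) *
         Res_all k (wmult (separate_prod k (C_alpha \<alpha>)) (sq_vandermonde k))) \<and>
       cconst (1 / fact k) * Res_all k (wmult (separate_prod k (C_alpha \<alpha>)) (sq_vandermonde k)) =
         cconst ((-1) powi (int k * \<alpha>)) * det (mat k k (\<lambda>(i, j). cvar (\<alpha> + int i + int j))))"
proof (intro conjI allI impI)
  show "tau 0 \<alpha> = ser_of_poly 1"
    using tau_nonneg[of 0 \<alpha>] by (simp add: hankel_submatrix_def det_dim_zero)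
qed (simp_all only: tau_neg tau_nonneg Res_hankel det_hankel)

end
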